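(* For every fixed $k$, STAR $k$-COLORING is in $\mathsf{NP}$ when the input is restricted to $\{W_4, \text{dart}, \text{gem}\}$-free graphs.
   Context: All graphs are finite and simple. A star of $G$ is a set $W\subseteq V(G)$ with $G[W]\cong K_{1,m}$ ($m\ge1$); a maximal star is a star not properly contained in another star. A $k$-coloring is a map $\rho:V(G)\to\{1,\dots,k\}$; a set $W$ is monochromatic if $|\rho(W)|=1$. A star $k$-coloring has no monochromatic maximal star. STAR $k$-COLORING: given a connected graph $G$, decide whether $G$ admits a star $k$-coloring. The diamond is $K_4$ minus an edge; $W_4$ is the 4-cycle plus a vertex adjacent to all four cycle vertices; the gem is the path $P_4$ plus a vertex adjacent to all its vertices; the dart is a diamond plus an extra vertex adjacent only to one of the two degree-3 vertices of the diamond. $\{W_4,\text{dart},\text{gem}\}$-free means no induced subgraph isomorphic to any of them. *)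

theory Defs
  imports
    "Graph_Theory.Graph_Theory"
    "HOL-Computational_Algebra.Polynomial"
begin

section \<open>Deterministic multi-tape Turing machines\<close>

text \<open>
  States and tape symbols are initial segments of the naturals. Symbol 0 is the blank, 1 and 2 are
  the input bits; a machine may use further work symbols. Tapes are infinite in both directions.
\<close>

datatype head_move = Move_Left | Stay | Move_Right

record turing_machine =
  num_tapes :: nat
  num_symbols :: nat
  num_states :: nat
  start_state :: nat
  accept_state :: nat
  reject_state :: nat
  transition :: "nat \<Rightarrow> nat list \<Rightarrow> nat \<times> (nat \<times> head_move) list"

definition wf_tm :: "turing_machine \<Rightarrow> bool" where
  "wf_tm M \<longleftrightarrow>
     num_tapes M \<ge> 1 \<and> num_symbols M \<ge> 3 \<and>
     start_state M < num_states M \<and> accept_state M < num_states M \<and> reject_state M < num_states M \<and>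
     accept_state M \<noteq> reject_state M \<and>
     (\<forall>q < num_states M. \<forall>s. length s = num_tapes M \<and> set s \<subseteq> {..<num_symbols M} \<longrightarrow>
        (case transition M q s of (q', acts) \<Rightarrow>
           q' < num_states M \<and> length acts = num_tapes M \<and> fst ` set acts \<subseteq> {..<num_symbols M}))"

text \<open>A tape is its contents together with the position of the head.\<close>

type_synonym tape = "(int \<Rightarrow> nat) \<times> int"
type_synonym tm_config = "nat \<times> tape list"

fun tape_read :: "tape \<Rightarrow> nat" where
  "tape_read (t, p) = t p"

fun move_head :: "head_move \<Rightarrow> int \<Rightarrow> int" where
  "move_head Move_Left p = p - 1"
| "move_head Stay p = p"
| "move_head Move_Right p = p + 1"

fun tape_act :: "nat \<times> head_move \<Rightarrow> tape \<Rightarrow> tape" where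
  "tape_act (s, d) (t, p) = (t(p := s), move_head d p)"

fun tm_step :: "turing_machine \<Rightarrow> tm_config \<Rightarrow> tm_config" where
  "tm_step M (q, ts) =
     (if q = accept_state M \<or> q = reject_state M then (q, ts)
      else case transition M q (map tape_read ts) of (q', acts) \<Rightarrow> (q', map2 tape_act acts ts))"

definition bit_symbol :: "bool \<Rightarrow> nat" where
  "bit_symbol b = (if b then 2 else 1)"

definition blank_tape :: tape where
  "blank_tape = (\<lambda>_. 0, 0)"

definition input_tape :: "bool list \<Rightarrow> tape" where
  "input_tape w = (\<lambda>i. if 0 \<le> i \<and> i < int (length w) then bit_symbol (w ! nat i) else 0, 0)"

definition tm_init :: "turing_machine \<Rightarrow> bool list \<Rightarrow> tm_config" where
  "tm_init M w = (start_state M, input_tape w # replicate (num_tapes M - 1) blank_tape)"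

definition tm_decides_in_time :: "turing_machine \<Rightarrow> bool list set \<Rightarrow> (nat \<Rightarrow> nat) \<Rightarrow> bool" where
  "tm_decides_in_time M L T \<longleftrightarrow>
     (\<forall>w. \<exists>t \<le> T (length w).
        fst ((tm_step M ^^ t) (tm_init M w)) = (if w \<in> L then accept_state M else reject_state M))"

section \<open>The classes P and NP\<close>

definition class_P :: "bool list set set" where
  "class_P = {L. \<exists>M (p :: nat poly). wf_tm M \<and> tm_decides_in_time M L (poly p)}"

text \<open>Self-delimiting pairing: the bits of the first word are doubled and 01 is the separator.\<close>

definition word_pair :: "bool list \<Rightarrow> bool list \<Rightarrow> bool list" where
  "word_pair x u = concat (map (\<lambda>b. [b, b]) x) @ [False, True] @ u"

definition class_NP :: "bool list set set" where
  "class_NP = {L. \<exists>V \<in> class_P. \<exists>p :: nat poly.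
     \<forall>x. x \<in> L \<longleftrightarrow> (\<exists>u. length u \<le> poly p (length x) \<and> word_pair x u \<in> V)}"

section \<open>Star colorings\<close>

text \<open>
  As in the graph library, an undirected graph is a symmetric digraph; finite simple graphs are
  those satisfying \<^const>\<open>graph\<close>, or \<^const>\<open>pair_graph\<close> when arcs are pairs of vertices.
\<close>

definition is_star :: "('a, 'b) pre_digraph \<Rightarrow> 'a set \<Rightarrow> bool" where
  "is_star G W \<longleftrightarrow> W \<subseteq> verts G \<and> (\<exists>m \<ge> 1. complete_bipartite_digraph 1 m (G \<restriction> W))"

definition is_maximal_star :: "('a, 'b) pre_digraph \<Rightarrow> 'a set \<Rightarrow> bool" where
  "is_maximal_star G W \<longleftrightarrow> is_star G W \<and> (\<nexists>W'. is_star G W' \<and> W \<subset> W')"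

definition is_coloring :: "nat \<Rightarrow> ('a, 'b) pre_digraph \<Rightarrow> ('a \<Rightarrow> nat) \<Rightarrow> bool" where
  "is_coloring k G \<rho> \<longleftrightarrow> \<rho> ` verts G \<subseteq> {1..k}"

definition monochromatic :: "('a \<Rightarrow> nat) \<Rightarrow> 'a set \<Rightarrow> bool" where
  "monochromatic \<rho> W \<longleftrightarrow> card (\<rho> ` W) = 1"

definition is_star_coloring :: "nat \<Rightarrow> ('a, 'b) pre_digraph \<Rightarrow> ('a \<Rightarrow> nat) \<Rightarrow> bool" where
  "is_star_coloring k G \<rho> \<longleftrightarrow>
     is_coloring k G \<rho> \<and> (\<nexists>W. is_maximal_star G W \<and> monochromatic \<rho> W)"

section \<open>Forbidden induced subgraphs\<close>

definition undirected :: "'a set \<Rightarrow> 'a rel \<Rightarrow> 'a pair_pre_digraph" where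
  "undirected V E = \<lparr> pverts = V, parcs = E \<union> E\<inverse> \<rparr>"

definition W4_graph :: "nat pair_pre_digraph" where
  "W4_graph = undirected {0,1,2,3,4}
     {(0,1), (1,2), (2,3), (3,0), (4,0), (4,1), (4,2), (4,3)}"

text \<open>The diamond on 0, 1, 2, 3 lacks the edge 23; its degree-3 vertices are 0 and 1.\<close>

definition dart_graph :: "nat pair_pre_digraph" where
  "dart_graph = undirected {0,1,2,3,4}
     {(0,1), (0,2), (0,3), (1,2), (1,3), (4,0)}"

definition gem_graph :: "nat pair_pre_digraph" where
  "gem_graph = undirected {0,1,2,3,4}
     {(0,1), (1,2), (2,3), (4,0), (4,1), (4,2), (4,3)}"

definition induced_free :: "('c, 'd) pre_digraph \<Rightarrow> ('a, 'b) pre_digraph \<Rightarrow> bool" where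
  "induced_free H G \<longleftrightarrow> (\<nexists>W. W \<subseteq> verts G \<and> digraph_iso (G \<restriction> W) H)"

definition W4_dart_gem_free :: "('a, 'b) pre_digraph \<Rightarrow> bool" where
  "W4_dart_gem_free G \<longleftrightarrow>
     induced_free (with_proj W4_graph) G \<and>
     induced_free (with_proj dart_graph) G \<and>
     induced_free (with_proj gem_graph) G"

section \<open>The decision problem\<close>

text \<open>
  An input graph has vertices \<open>0, \<dots>, n - 1\<close> and is presented by its \<open>n \<times> n\<close> adjacency matrix,
  row by row.
\<close>

definition adjacency_code :: "nat pair_pre_digraph \<Rightarrow> bool list" where
  "adjacency_code G =
     (let n = card (pverts G) in map (\<lambda>e. e \<in> parcs G) (List.product [0..<n] [0..<n]))"

text \<open>
  The language of yes-instances of \<open>STAR k-COLORING\<close> with inputs restricted to the graph class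
  \<open>C\<close>. The name \<open>connected\<close> is qualified because of its topological namesake.
\<close>

definition STAR_COLORING ::
    "nat \<Rightarrow> ((nat, nat \<times> nat) pre_digraph \<Rightarrow> bool) \<Rightarrow> bool list set" where
  "STAR_COLORING k C = {adjacency_code G | G.
     pair_graph G \<and> (\<exists>n. pverts G = {..<n}) \<and> Digraph_Component.connected (with_proj G) \<and>
     C (with_proj G) \<and> (\<exists>\<rho>. is_star_coloring k (with_proj G) \<rho>)}"

end

theory Submission
  imports Defs "HOL-Library.Countable"
begin

text \<open>
  In a graph without induced \<open>W\<^sub>4\<close>, dart and gem, the neighborhood of a vertex \<open>v\<close> is a clique
  joined to a disjoint union of cliques. A star with center \<open>v\<close> and at least two leaves is maximal
  iff its leaves form a transversal of the disjoint cliques. So although there may be exponentially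
  many maximal stars, a color class contains one with center \<open>v\<close> iff it contains \<open>v\<close> and meets each
  of these cliques. Maximal stars on two vertices are pairs of adjacent twins. Being a star coloring
  is therefore a first-order property of the graph and the color classes, and so is the absence of
  the forbidden subgraphs; connectedness becomes first-order once a strict order of the vertices, in
  which all but one have a smaller neighbor, is guessed as well. Hence the problem is definable in
  existential second-order logic, and Fagin's theorem applies: the guessed relations are the
  certificate, and first-order formulas are evaluated by nested loops over counters, which are heads
  of a Turing machine.
\<close>

section \<open>Counter programs\<close>

text \<open>
  A register with value \<open>v\<close> is a Turing machine head \<open>v\<close> cells to the right of a marker, the
  symbol 3. Behind the marker the tape of register 0 holds the input word and all other tapes are
  blank; programs never write.
\<close>

datatype com =
    Skip
  | Inc nat
  | Dec nat
  | Seq com com (infixr \<open>;;\<close> 60)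
  | If_Sym nat nat com com
  | While_Not nat nat com

instance com :: countable
  by countable_datatype

definition register_symbol :: "bool list \<Rightarrow> nat \<Rightarrow> nat \<Rightarrow> nat" where
  "register_symbol w i v =
     (if v = 0 then 3 else if i = 0 \<and> v \<le> length w then bit_symbol (w ! (v - 1)) else 0)"

fun com_next :: "com \<Rightarrow> (nat \<Rightarrow> nat) \<Rightarrow> com \<times> nat \<times> head_move" where
  "com_next Skip \<sigma> = (Skip, 0, Stay)"
| "com_next (Inc i) \<sigma> = (Skip, i, Move_Right)"
| "com_next (Dec i) \<sigma> = (Skip, i, if \<sigma> i = 3 then Stay else Move_Left)"
| "com_next (c1 ;; c2) \<sigma> =
     (if c1 = Skip then (c2, 0, Stay) else case com_next c1 \<sigma> of (c, m) \<Rightarrow> (c ;; c2, m))"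
| "com_next (If_Sym i a c1 c2) \<sigma> = (if \<sigma> i = a then c1 else c2, 0, Stay)"
| "com_next (While_Not i a c) \<sigma> = (if \<sigma> i = a then Skip else c ;; While_Not i a c, 0, Stay)"

fun counter_move :: "head_move \<Rightarrow> nat \<Rightarrow> nat" where
  "counter_move Move_Left v = v - 1"
| "counter_move Stay v = v"
| "counter_move Move_Right v = Suc v"

fun com_step :: "bool list \<Rightarrow> com \<times> (nat \<Rightarrow> nat) \<Rightarrow> com \<times> (nat \<Rightarrow> nat)" where
  "com_step w (c, s) = (case com_next c (\<lambda>i. register_symbol w i (s i)) of (c', i, d) \<Rightarrow>
     (c', s(i := counter_move d (s i))))"

definition runs :: "bool list \<Rightarrow> com \<Rightarrow> (nat \<Rightarrow> nat) \<Rightarrow> nat \<Rightarrow> (nat \<Rightarrow> nat) \<Rightarrow> bool" where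
  "runs w c s t s' \<longleftrightarrow> (com_step w ^^ t) (c, s) = (Skip, s')"

lemma register_symbol_eq_3_iff [simp]: "register_symbol w i v = 3 \<longleftrightarrow> v = 0"
  by (auto simp: register_symbol_def bit_symbol_def)

lemma register_symbol_input_eq_0_iff [simp]: "register_symbol w 0 v = 0 \<longleftrightarrow> length w < v"
  by (auto simp: register_symbol_def bit_symbol_def)

lemma register_symbol_input_eq_2_iff [simp]:
  "register_symbol w 0 (Suc v) = 2 \<longleftrightarrow> v < length w \<and> w ! v"
  by (auto simp: register_symbol_def bit_symbol_def)

lemma funpow_com_step_Skip [simp]: "(com_step w ^^ t) (Skip, s) = (Skip, s)"
  by (induction t) auto

lemma runs_mono:
  assumes "runs w c s t s'" "t \<le> t'"
  shows "runs w c s t' s'"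
proof -
  have "(com_step w ^^ t') (c, s) = (com_step w ^^ (t' - t)) ((com_step w ^^ t) (c, s))"
    using assms(2) by (metis comp_apply funpow_add le_add_diff_inverse2)
  then show ?thesis
    using assms(1) by (simp add: runs_def)
qed

lemma runs_cong: "runs w c s t s1 \<Longrightarrow> s1 = s' \<Longrightarrow> t \<le> t' \<Longrightarrow> runs w c s t' s'"
  using runs_mono by blast

lemma runs_Suc: "runs w c s (Suc t) s' \<longleftrightarrow> (case com_step w (c, s) of (c', s1) \<Rightarrow> runs w c' s1 t s')"
  by (simp add: runs_def funpow_Suc_right del: funpow.simps com_step.simps split: prod.split)

lemma runs_Skip [simp]: "runs w Skip s t s' \<longleftrightarrow> s' = s"
  by (auto simp: runs_def)

lemma runs_Inc: "runs w (Inc i) s 1 (s(i := Suc (s i)))"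
  by (simp add: runs_Suc)

lemma runs_Dec: "runs w (Dec i) s 1 (s(i := s i - 1))"
  by (simp add: runs_Suc fun_eq_iff)

lemma runs_Seq:
  assumes "runs w c1 s t1 s1" "runs w c2 s1 t2 s2"
  shows "runs w (c1 ;; c2) s (t1 + t2 + 1) s2"
  using assms(1)
proof (induction t1 arbitrary: c1 s)
  case 0
  then have "c1 = Skip" "s1 = s"
    by (auto simp: runs_def)
  then have "runs w c2 s t2 s2"
    using assms(2) by blast
  then show ?case
    by (simp add: \<open>c1 = Skip\<close> runs_Suc)
next
  case (Suc t)
  show ?case
  proof (cases "c1 = Skip")
    case True
    then have "runs w c2 s t2 s2"
      using Suc.prems assms(2) by (metis runs_Skip)
    then have "runs w (c1 ;; c2) s (Suc t2) s2"
      by (simp add: True runs_Suc)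
    then show ?thesis
      by (rule runs_mono) simp
  next
    case False
    obtain c' i d where next_c1: "com_next c1 (\<lambda>i. register_symbol w i (s i)) = (c', i, d)"
      by (metis prod_cases3)
    have "runs w c' (s(i := counter_move d (s i))) t s1"
      using Suc.prems next_c1 by (simp add: runs_Suc)
    then have "runs w (c' ;; c2) (s(i := counter_move d (s i))) (t + t2 + 1) s2"
      by (rule Suc.IH)
    then show ?thesis
      using False next_c1 runs_Suc[of w "c1 ;; c2" s "t + t2 + 1"] by simp
  qed
qed

lemma runs_If_Sym:
  assumes "register_symbol w i (s i) = a \<Longrightarrow> runs w c1 s t s'"
    and "register_symbol w i (s i) \<noteq> a \<Longrightarrow> runs w c2 s t s'"
  shows "runs w (If_Sym i a c1 c2) s (t + 1) s'"
  using assms by (auto simp: runs_Suc)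

lemma runs_While_Not:
  assumes "\<And>j. j < n \<Longrightarrow> register_symbol w r (S j r) \<noteq> a"
    and "\<And>j. j < n \<Longrightarrow> runs w c (S j) t (S (Suc j))"
    and "register_symbol w r (S n r) = a"
  shows "runs w (While_Not r a c) (S 0) (n * (t + 2) + 1) (S n)"
  using assms
proof (induction n arbitrary: S)
  case 0
  then show ?case
    by (simp add: runs_Suc)
next
  case (Suc n)
  have "runs w (While_Not r a c) (S (Suc 0)) (n * (t + 2) + 1) (S (Suc n))"
    using Suc.IH[of "\<lambda>j. S (Suc j)"] Suc.prems by simp
  then have "runs w (c ;; While_Not r a c) (S 0) (t + (n * (t + 2) + 1) + 1) (S (Suc n))"
    using Suc.prems(2)[of 0] by (intro runs_Seq) auto
  then have "runs w (While_Not r a c) (S 0) (Suc (t + (n * (t + 2) + 1) + 1)) (S (Suc n))"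
    using Suc.prems(1)[of 0] by (simp add: runs_Suc)
  then show ?case
    by (rule runs_mono) simp
qed

section \<open>Simulation by a Turing machine\<close>

text \<open>The finitely many programs that remain during an execution serve as states of the machine.\<close>

fun residuals :: "com \<Rightarrow> com set" where
  "residuals Skip = {Skip}"
| "residuals (Inc i) = {Inc i, Skip}"
| "residuals (Dec i) = {Dec i, Skip}"
| "residuals (c1 ;; c2) = (\<lambda>c. c ;; c2) ` residuals c1 \<union> residuals c2"
| "residuals (If_Sym i a c1 c2) = {If_Sym i a c1 c2} \<union> residuals c1 \<union> residuals c2"
| "residuals (While_Not i a c) =
     {While_Not i a c, Skip} \<union> (\<lambda>c'. c' ;; While_Not i a c) ` residuals c"

lemma finite_residuals: "finite (residuals c)"
  by (induction c) auto

lemma self_in_residuals: "c \<in> residuals c"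
  by (induction c) auto

lemma Skip_in_residuals: "Skip \<in> residuals c"
  by (induction c) auto

lemma com_next_in_residuals: "c' \<in> residuals c \<Longrightarrow> fst (com_next c' \<sigma>) \<in> residuals c"
proof (induction c arbitrary: c')
  case (Seq c1 c2)
  then consider "c' \<in> residuals c2" | d where "d \<in> residuals c1" "c' = d ;; c2"
    by auto
  then show ?case
  proof cases
    case 1
    then show ?thesis
      using Seq.IH(2) by auto
  next
    case 2
    then show ?thesis
      using Seq.IH(1)[of d] by (auto simp: self_in_residuals split: prod.split)
  qed
next
  case (While_Not i a c)
  then consider "c' = While_Not i a c \<or> c' = Skip"
    | d where "d \<in> residuals c" "c' = d ;; While_Not i a c"
    by auto
  then show ?case
  proof cases
    case 1
    then show ?thesis
      using self_in_residuals[of c] by (cases "\<sigma> i = a") auto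
  next
    case 2
    then show ?thesis
      using While_Not.IH[of d] by (auto split: prod.split)
  qed
qed (auto simp: self_in_residuals)

text \<open>At least two registers are counted because register 1 receives the answer of a program.\<close>

fun reg_bound :: "com \<Rightarrow> nat" where
  "reg_bound Skip = 2"
| "reg_bound (Inc i) = i + 2"
| "reg_bound (Dec i) = i + 2"
| "reg_bound (c1 ;; c2) = max (reg_bound c1) (reg_bound c2)"
| "reg_bound (If_Sym i a c1 c2) = max (i + 2) (max (reg_bound c1) (reg_bound c2))"
| "reg_bound (While_Not i a c) = max (i + 2) (reg_bound c)"

lemma reg_bound_ge_2: "2 \<le> reg_bound c"
  by (induction c) auto

lemma reg_bound_pos [simp]: "0 < reg_bound c"
  using reg_bound_ge_2[of c] by simp

lemma reg_bound_residual: "c' \<in> residuals c \<Longrightarrow> reg_bound c' \<le> reg_bound c"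
  by (induction c arbitrary: c') (fastforce simp: reg_bound_ge_2 max_def)+

lemma com_next_cong:
  "(\<And>i. i < reg_bound c \<Longrightarrow> \<sigma> i = \<tau> i) \<Longrightarrow> com_next c \<sigma> = com_next c \<tau>"
  by (induction c) (auto split: prod.split)

lemma com_next_Move_Left: "com_next c \<sigma> = (c', i, Move_Left) \<Longrightarrow> \<sigma> i \<noteq> 3"
  by (induction c arbitrary: c') (auto split: if_splits prod.splits)

definition initial_cells :: "bool list \<Rightarrow> nat \<Rightarrow> int \<Rightarrow> nat" where
  "initial_cells w i = (if i = 0 then fst (input_tape w) else (\<lambda>_. 0))"

definition register_tape :: "bool list \<Rightarrow> nat \<Rightarrow> nat \<Rightarrow> tape" where
  "register_tape w i v = ((initial_cells w i)(-1 := 3), int v - 1)"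

lemma tape_read_register_tape [simp]: "tape_read (register_tape w i v) = register_symbol w i v"
  by (auto simp: register_tape_def initial_cells_def input_tape_def register_symbol_def
      nat_diff_distrib)

lemma tape_act_register_tape:
  "(d = Move_Left \<Longrightarrow> v \<noteq> 0) \<Longrightarrow>
   tape_act (register_symbol w i v, d) (register_tape w i v) = register_tape w i (counter_move d v)"
  using tape_read_register_tape[of w i v]
  by (cases d) (auto simp: register_tape_def fun_eq_iff simp del: tape_read_register_tape)

definition state_code :: "com \<Rightarrow> nat" where
  "state_code c = to_nat c + 4"

text \<open>
  States 0 and 1 put the markers on the cells to the left of the initial head positions. States 2
  and 3 accept and reject.
\<close>

definition program_transition :: "com \<Rightarrow> nat \<Rightarrow> nat list \<Rightarrow> nat \<times> (nat \<times> head_move) list" where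
  "program_transition c0 q ss =
     (if q = 0 then (1, map (\<lambda>a. (a, Move_Left)) ss)
      else if q = 1 then (state_code c0, map (\<lambda>a. (3, Stay)) ss)
      else let c = from_nat (q - 4) in
        if q < 4 \<or> c \<notin> residuals c0 then (q, map (\<lambda>a. (a, Stay)) ss)
        else if c = Skip then (if ss ! 1 = 3 then 3 else 2, map (\<lambda>a. (a, Stay)) ss)
        else case com_next c (\<lambda>i. ss ! i) of (c', i, d) \<Rightarrow>
          (state_code c', map (\<lambda>j. (ss ! j, if j = i then d else Stay)) [0..<length ss]))"

definition program_machine :: "com \<Rightarrow> turing_machine" where
  "program_machine c0 = \<lparr>
     num_tapes = reg_bound c0, num_symbols = 4,
     num_states = Suc (Max (state_code ` residuals c0)),
     start_state = 0, accept_state = 2, reject_state = 3,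
     transition = program_transition c0 \<rparr>"

lemma state_code_less_num_states:
  "c \<in> residuals c0 \<Longrightarrow> state_code c < num_states (program_machine c0)"
  by (simp add: program_machine_def less_Suc_eq_le finite_residuals)

lemma special_state_less_num_states: "q < 4 \<Longrightarrow> q < num_states (program_machine c0)"
  using state_code_less_num_states[OF self_in_residuals, of c0] by (simp add: state_code_def)

lemma program_transition_wf:
  assumes q: "q < num_states (program_machine c0)"
    and ss: "length ss = reg_bound c0" "set ss \<subseteq> {..<4}"
  shows "case program_transition c0 q ss of (q', acts) \<Rightarrow>
    q' < num_states (program_machine c0) \<and> length acts = reg_bound c0 \<and> fst ` set acts \<subseteq> {..<4}"
proof -
  let ?c = "from_nat (q - 4) :: com"
  have symbol: "a < 4" if "a \<in> set ss" for a
    using ss(2) that by blast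
  consider "q < 4 \<or> ?c \<notin> residuals c0 \<or> ?c = Skip" | "4 \<le> q" "?c \<in> residuals c0" "?c \<noteq> Skip"
    by linarith
  then show ?thesis
  proof cases
    case 1
    have "state_code c0 < num_states (program_machine c0)"
      using state_code_less_num_states[OF self_in_residuals] .
    then show ?thesis
      using 1 q ss(1) symbol
      by (auto simp: program_transition_def Let_def special_state_less_num_states)
  next
    case 2
    obtain c' i d where next_c: "com_next ?c (\<lambda>i. ss ! i) = (c', i, d)"
      by (metis prod_cases3)
    then have "state_code c' < num_states (program_machine c0)"
      using state_code_less_num_states com_next_in_residuals[OF 2(2)] by (metis fst_conv)
    then show ?thesis
      using 2 ss(1) symbol next_c by (auto simp: program_transition_def)
  qed
qed

lemma wf_tm_program_machine: "wf_tm (program_machine c0)"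
  unfolding wf_tm_def
  using program_transition_wf[of _ c0] special_state_less_num_states[of 0 c0]
    special_state_less_num_states[of 2 c0] special_state_less_num_states[of 3 c0]
  by (simp add: program_machine_def Suc_leI)

lemma tm_step_map:
  assumes "q \<noteq> accept_state M" "q \<noteq> reject_state M"
    and "transition M q (map (\<lambda>i. tape_read (T i)) is) = (q', map A is)"
  shows "tm_step M (q, map T is) = (q', map (\<lambda>i. tape_act (A i) (T i)) is)"
  using assms by (simp add: comp_def map2_map_map)

definition program_config :: "com \<Rightarrow> bool list \<Rightarrow> com \<times> (nat \<Rightarrow> nat) \<Rightarrow> tm_config" where
  "program_config c0 w = (\<lambda>(c, s).
     (state_code c, map (\<lambda>i. register_tape w i (s i)) [0..<reg_bound c0]))"

lemma tm_init_program_machine: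
  "tm_init (program_machine c0) w = (0, map (\<lambda>i. (initial_cells w i, 0)) [0..<reg_bound c0])"
proof -
  have "map (\<lambda>i. (initial_cells w i, 0)) [1..<reg_bound c0] =
      replicate (reg_bound c0 - 1) blank_tape"
    by (rule nth_equalityI) (auto simp: initial_cells_def blank_tape_def)
  then show ?thesis
    by (simp add: tm_init_def program_machine_def initial_cells_def input_tape_def upt_conv_Cons)
qed

lemma program_machine_setup:
  "(tm_step (program_machine c0) ^^ 2) (tm_init (program_machine c0) w) =
    program_config c0 w (c0, \<lambda>_. 0)"
proof -
  let ?M = "program_machine c0" and ?rs = "[0..<reg_bound c0]"
  have "tm_step ?M (tm_init ?M w) =
      (1, map (\<lambda>i. tape_act (initial_cells w i 0, Move_Left) (initial_cells w i, 0)) ?rs)"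
    unfolding tm_init_program_machine
    by (rule tm_step_map) (simp_all add: program_machine_def program_transition_def)
  moreover have "tm_step ?M (1, map (\<lambda>i. (initial_cells w i, -1)) ?rs) =
      (state_code c0, map (\<lambda>i. tape_act (3, Stay) (initial_cells w i, -1)) ?rs)"
    by (rule tm_step_map) (simp_all add: program_machine_def program_transition_def)
  ultimately show ?thesis
    by (simp add: numeral_2_eq_2 program_config_def register_tape_def)
qed

lemma tm_step_program_config:
  assumes c: "c \<in> residuals c0" and "c \<noteq> Skip"
  shows "tm_step (program_machine c0) (program_config c0 w (c, s)) =
    program_config c0 w (com_step w (c, s))"
proof -
  let ?\<sigma> = "\<lambda>i. register_symbol w i (s i)" and ?rs = "[0..<reg_bound c0]"
  obtain c' i d where next_c: "com_next c ?\<sigma> = (c', i, d)"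
    by (metis prod_cases3)
  have "reg_bound c \<le> reg_bound c0"
    using reg_bound_residual[OF c] .
  then have "com_next c (\<lambda>j. map ?\<sigma> ?rs ! j) = (c', i, d)"
    using next_c by (subst com_next_cong[of c _ ?\<sigma>]) auto
  then have "tm_step (program_machine c0) (program_config c0 w (c, s)) =
      (state_code c', map (\<lambda>j. tape_act (map ?\<sigma> ?rs ! j, if j = i then d else Stay)
        (register_tape w j (s j))) ?rs)"
    unfolding program_config_def prod.case using assms
    by (intro tm_step_map) (simp_all add: program_machine_def program_transition_def state_code_def)
  moreover have "tape_act (map ?\<sigma> ?rs ! j, if j = i then d else Stay) (register_tape w j (s j)) =
      register_tape w j ((s(i := counter_move d (s i))) j)" if "j < reg_bound c0" for j
    using that com_next_Move_Left[of c ?\<sigma> c' i] next_c tape_act_register_tape[of Stay]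
    by (auto simp: tape_act_register_tape)
  ultimately show ?thesis
    using next_c by (simp add: program_config_def)
qed

lemma program_machine_simulates_runs:
  assumes "runs w c s t s'" "c \<in> residuals c0"
  shows "\<exists>t' \<le> t. (tm_step (program_machine c0) ^^ t') (program_config c0 w (c, s)) =
    program_config c0 w (Skip, s')"
  using assms
proof (induction t arbitrary: c s)
  case 0
  then show ?case
    by (simp add: runs_def)
next
  case (Suc t)
  show ?case
  proof (cases "c = Skip")
    case True
    then show ?thesis
      using Suc.prems by (intro exI[of _ 0]) simp
  next
    case False
    obtain c' s1 where step: "com_step w (c, s) = (c', s1)"
      by fastforce
    have "runs w c' s1 t s'"
      using Suc.prems(1) step by (simp add: runs_Suc del: com_step.simps)
    moreover have "c' \<in> residuals c0"
      using com_next_in_residuals[OF Suc.prems(2), of "\<lambda>i. register_symbol w i (s i)"] step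
      by (auto split: prod.splits)
    ultimately obtain t' where "t' \<le> t"
        "(tm_step (program_machine c0) ^^ t') (program_config c0 w (c', s1)) =
          program_config c0 w (Skip, s')"
      using Suc.IH by blast
    then show ?thesis
      using tm_step_program_config[OF Suc.prems(2) False, of w s] step
      by (intro exI[of _ "Suc t'"]) (simp add: funpow_Suc_right del: funpow.simps com_step.simps)
  qed
qed

lemma program_machine_answer:
  "fst (tm_step (program_machine c0) (program_config c0 w (Skip, s))) = (if s 1 = 0 then 3 else 2)"
  using reg_bound_ge_2[of c0] Skip_in_residuals[of c0]
  by (simp add: program_config_def program_machine_def program_transition_def state_code_def)

lemma program_machine_decides:
  assumes "runs w c (\<lambda>_. 0) t s"
  shows "\<exists>t' \<le> t + 3. fst ((tm_step (program_machine c) ^^ t') (tm_init (program_machine c) w)) =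
    (if s 1 = 0 then 3 else 2)"
proof -
  let ?M = "program_machine c"
  obtain t' where "t' \<le> t"
      and final: "(tm_step ?M ^^ t') (program_config c w (c, \<lambda>_. 0)) = program_config c w (Skip, s)"
    using program_machine_simulates_runs[OF assms self_in_residuals] by blast
  have "(tm_step ?M ^^ Suc (t' + 2)) (tm_init ?M w) = tm_step ?M (program_config c w (Skip, s))"
    by (simp only: funpow.simps funpow_add comp_apply program_machine_setup final)
  then show ?thesis
    using \<open>t' \<le> t\<close> program_machine_answer by (intro exI[of _ "Suc (t' + 2)"]) simp
qed

theorem program_in_class_P:
  assumes "\<And>w. \<exists>s. runs w c (\<lambda>_. 0) (poly p (length w)) s \<and> (s 1 \<noteq> 0 \<longleftrightarrow> w \<in> L)"
  shows "L \<in> class_P"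
proof -
  let ?M = "program_machine c"
  have "\<exists>t \<le> poly (p + 3) (length w). fst ((tm_step ?M ^^ t) (tm_init ?M w)) =
      (if w \<in> L then accept_state ?M else reject_state ?M)" for w
  proof -
    obtain s where "runs w c (\<lambda>_. 0) (poly p (length w)) s" "s 1 \<noteq> 0 \<longleftrightarrow> w \<in> L"
      using assms by blast
    then show ?thesis
      using program_machine_decides[of w c] by (fastforce simp: program_machine_def)
  qed
  then show ?thesis
    unfolding class_P_def tm_decides_in_time_def using wf_tm_program_machine by blast
qed

section \<open>Polynomially computable functions\<close>

definition For :: "nat \<Rightarrow> com \<Rightarrow> com" where
  "For r c = While_Not r 3 (Dec r ;; c)"

definition clear :: "nat \<Rightarrow> com" where
  "clear r = For r Skip"

definition add_into :: "nat \<Rightarrow> nat \<Rightarrow> com" where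
  "add_into r d = For r (Inc d)"

definition subtract_from :: "nat \<Rightarrow> nat \<Rightarrow> com" where
  "subtract_from r d = For r (Dec d)"

definition copy_via :: "nat \<Rightarrow> nat \<Rightarrow> nat \<Rightarrow> com" where
  "copy_via x r d = For r (Inc d ;; Inc x) ;; add_into x r"

text \<open>The invariant \<open>I j\<close> describes the other registers when the loop counter has come down to \<open>j\<close>.\<close>

lemma runs_For:
  assumes "\<And>j. j < n \<Longrightarrow> runs w c ((I (Suc j))(r := j)) t ((I j)(r := j))"
  shows "runs w (For r c) ((I n)(r := n)) (n * (t + 4) + 1) ((I 0)(r := 0))"
proof -
  let ?S = "\<lambda>j. (I (n - j))(r := n - j)"
  have "runs w (While_Not r 3 (Dec r ;; c)) (?S 0) (n * (t + 2 + 2) + 1) (?S n)"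
  proof (rule runs_While_Not)
    fix j assume j: "j < n"
    have "runs w (Dec r) (?S j) 1 ((I (Suc (n - Suc j)))(r := n - Suc j))"
      by (rule runs_cong[OF runs_Dec]) (use j in \<open>auto simp: Suc_diff_Suc\<close>)
    from runs_Seq[OF this assms[of "n - Suc j"]] j
    show "runs w (Dec r ;; c) (?S j) (t + 2) (?S (Suc j))"
      by (auto elim: runs_cong)
  qed auto
  then show ?thesis
    by (auto simp: For_def algebra_simps elim: runs_cong)
qed

lemma runs_clear: "runs w (clear r) s (s r * 4 + 1) (s(r := 0))"
  using runs_For[of "s r" w Skip "\<lambda>_. s" r 0] by (simp add: clear_def)

lemma runs_For_update:
  assumes "r \<noteq> d" and update: "\<And>s. runs w c s t (s(d := f (s d)))"
  shows "runs w (For r c) s (s r * (t + 4) + 1) (s(r := 0, d := (f ^^ s r) (s d)))"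
proof -
  let ?I = "\<lambda>j. s(d := (f ^^ (s r - j)) (s d))"
  have "runs w (For r c) ((?I (s r))(r := s r)) (s r * (t + 4) + 1) ((?I 0)(r := 0))"
  proof (rule runs_For)
    fix j assume "j < s r"
    then have "s r - j = Suc (s r - Suc j)"
      by simp
    then show "runs w c ((?I (Suc j))(r := j)) t ((?I j)(r := j))"
      by (intro runs_cong[OF update]) (use assms(1) in \<open>auto simp: fun_eq_iff\<close>)
  qed
  then show ?thesis
    using assms(1) by (simp add: fun_upd_twist)
qed

lemma runs_add_into:
  assumes "r \<noteq> d"
  shows "runs w (add_into r d) s (s r * 5 + 1) (s(r := 0, d := s d + s r))"
  using runs_For_update[of r d w "Inc d" 1 Suc s, OF assms runs_Inc]
  by (simp add: add_into_def add.commute)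

lemma runs_subtract_from:
  assumes "r \<noteq> d"
  shows "runs w (subtract_from r d) s (s r * 5 + 1) (s(r := 0, d := s d - s r))"
proof -
  have "((\<lambda>v. v - 1) ^^ n) m = m - n" for m n :: nat
    by (induction n) auto
  then show ?thesis
    using runs_For_update[of r d w "Dec d" 1 "\<lambda>v. v - 1" s, OF assms runs_Dec]
    by (simp add: subtract_from_def)
qed

lemma runs_copy_via:
  assumes "r \<noteq> d" "r \<noteq> x" "x \<noteq> d" "s d = 0" "s x = 0"
  shows "runs w (copy_via x r d) s (s r * 12 + 3) (s(d := s r))"
proof -
  let ?I = "\<lambda>j. s(d := s r - j, x := s r - j)"
  have "runs w (For r (Inc d ;; Inc x)) ((?I (s r))(r := s r)) (s r * (3 + 4) + 1) ((?I 0)(r := 0))"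
    by (rule runs_For, rule runs_cong[OF runs_Seq[OF runs_Inc runs_Inc]])
       (use assms in \<open>auto simp: fun_eq_iff\<close>)
  moreover have "(?I (s r))(r := s r) = s"
    using assms by (auto simp: fun_eq_iff)
  ultimately have "runs w (For r (Inc d ;; Inc x)) s (s r * 7 + 1) ((?I 0)(r := 0))"
    by simp
  from runs_Seq[OF this runs_add_into[of x r]] show ?thesis
    unfolding copy_via_def by (rule runs_cong) (use assms in \<open>auto simp: fun_eq_iff\<close>)
qed

text \<open>
  Registers from \<open>d\<close> on are free for use. Register 0 is kept at 0 because its head is needed for
  reading the input. All numbers involved are bounded by \<open>B\<close>, the argument of the polynomials.
\<close>

definition stores ::
    "bool list \<Rightarrow> nat \<Rightarrow> (nat \<Rightarrow> nat) \<Rightarrow> nat \<Rightarrow> (nat \<Rightarrow> nat) \<Rightarrow> (nat \<Rightarrow> nat) \<Rightarrow> bool" where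
  "stores w B \<rho> d e s \<longleftrightarrow> length w \<le> B \<and> (\<forall>x. e x \<le> B \<and> \<rho> x < d \<and> s (\<rho> x) = e x) \<and>
     0 < d \<and> s 0 = 0 \<and> (\<forall>i \<ge> d. s i = 0)"

lemma stores_push: "stores w B \<rho> d e s \<Longrightarrow> stores w B \<rho> (Suc d) e (s(d := v))"
  by (auto simp: stores_def less_Suc_eq)

lemma stores_bind:
  "stores w B \<rho> d e s \<Longrightarrow> v \<le> B \<Longrightarrow> stores w B (\<rho>(x := d)) (Suc d) (e(x := v)) (s(d := v))"
  by (auto simp: stores_def less_Suc_eq)

lemma stores_mono: "stores w B \<rho> d e s \<Longrightarrow> B \<le> B' \<Longrightarrow> stores w B' \<rho> d e s"
  by (auto simp: stores_def intro: order_trans)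

lemma stores_free: "stores w B \<rho> d e s \<Longrightarrow> d \<le> i \<Longrightarrow> s i = 0"
  by (simp add: stores_def)

definition computes ::
    "((nat \<Rightarrow> nat) \<Rightarrow> nat \<Rightarrow> com) \<Rightarrow> nat poly \<Rightarrow> (bool list \<Rightarrow> (nat \<Rightarrow> nat) \<Rightarrow> nat) \<Rightarrow> bool" where
  "computes code p f \<longleftrightarrow> (\<forall>w B \<rho> d e s. stores w B \<rho> d e s \<longrightarrow>
     f w e \<le> poly p B \<and> runs w (code \<rho> d) s (poly p B) (s(d := f w e)))"

definition poly_computable :: "(bool list \<Rightarrow> (nat \<Rightarrow> nat) \<Rightarrow> nat) \<Rightarrow> bool" where
  "poly_computable f \<longleftrightarrow> (\<exists>code p. computes code p f)"

definition poly_decidable :: "(bool list \<Rightarrow> (nat \<Rightarrow> nat) \<Rightarrow> bool) \<Rightarrow> bool" where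
  "poly_decidable P \<longleftrightarrow> poly_computable (\<lambda>w e. of_bool (P w e))"

lemma computes_le: "computes code p f \<Longrightarrow> stores w B \<rho> d e s \<Longrightarrow> f w e \<le> poly p B"
  by (auto simp: computes_def)

lemma computes_runs:
  "computes code p f \<Longrightarrow> stores w B \<rho> d e s \<Longrightarrow> runs w (code \<rho> d) s (poly p B) (s(d := f w e))"
  by (auto simp: computes_def)

lemma poly_computableI:
  assumes "\<And>w B \<rho> d e s. stores w B \<rho> d e s \<Longrightarrow> f w e \<le> poly p B"
    and "\<And>w B \<rho> d e s. stores w B \<rho> d e s \<Longrightarrow> runs w (code \<rho> d) s (poly p B) (s(d := f w e))"
  shows "poly_computable f"
  using assms unfolding poly_computable_def computes_def by blast

lemma poly_decidableI:
  assumes "\<And>w B \<rho> d e s. stores w B \<rho> d e s \<Longrightarrow>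
    runs w (code \<rho> d) s (poly p B) (s(d := of_bool (P w e)))"
  shows "poly_decidable P"
  unfolding poly_decidable_def
proof (rule poly_computableI)
  fix w B \<rho> d e s assume "stores w B \<rho> d e s"
  from assms[OF this] show "runs w (code \<rho> d) s (poly (p + 1) B) (s(d := of_bool (P w e)))"
    by (rule runs_mono) simp
qed (simp add: of_bool_def)

lemma poly_computable_var: "poly_computable (\<lambda>w e. e x)"
proof (rule poly_computableI)
  fix w B \<rho> d e s assume stored: "stores w B \<rho> d e s"
  then have x: "e x \<le> B" "\<rho> x < d" "s (\<rho> x) = e x" and free: "s d = 0" "s (Suc d) = 0"
    by (simp_all add: stores_def)
  show "e x \<le> poly [:3, 12:] B"
    using x(1) by simp
  have "runs w (copy_via (Suc d) (\<rho> x) d) s (s (\<rho> x) * 12 + 3) (s(d := s (\<rho> x)))"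
    by (rule runs_copy_via) (use x(2) free in auto)
  then show "runs w (copy_via (Suc d) (\<rho> x) d) s (poly [:3, 12:] B) (s(d := e x))"
    by (rule runs_cong) (use x in auto)
qed

lemma poly_computable_0: "poly_computable (\<lambda>w e. 0)"
  by (rule poly_computableI[where p = 0 and code = "\<lambda>_ _. Skip"]) (auto simp: stores_def)

lemma poly_computable_Suc:
  assumes "poly_computable f"
  shows "poly_computable (\<lambda>w e. Suc (f w e))"
proof -
  obtain code p where f: "computes code p f"
    using assms unfolding poly_computable_def by blast
  show ?thesis
  proof (rule poly_computableI)
    fix w B \<rho> d e s assume stored: "stores w B \<rho> d e s"
    show "Suc (f w e) \<le> poly (p + 2) B"
      using computes_le[OF f stored] by simp
    from runs_Seq[OF computes_runs[OF f stored] runs_Inc[of w d]]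
    show "runs w (code \<rho> d ;; Inc d) s (poly (p + 2) B) (s(d := Suc (f w e)))"
      by (rule runs_cong) auto
  qed
qed

lemma poly_computable_const: "poly_computable (\<lambda>w e. n)"
  by (induction n) (auto intro: poly_computable_0 poly_computable_Suc)

lemma poly_computable_length: "poly_computable (\<lambda>w e. length w)"
proof (rule poly_computableI)
  fix w B \<rho> d e s assume stored: "stores w B \<rho> d e s"
  then have zero: "s d = 0" "s 0 = 0" "0 < d" and len: "length w \<le> B"
    by (auto simp: stores_def)
  show "length w \<le> poly [:9, 9:] B"
    using len by simp
  let ?S = "\<lambda>j. s(0 := Suc j, d := j)"
  have start: "runs w (Inc 0) s 1 (?S 0)"
    by (rule runs_cong[OF runs_Inc]) (use zero in \<open>auto simp: fun_eq_iff\<close>)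
  have scan: "runs w (While_Not 0 0 (Inc 0 ;; Inc d)) (?S 0) (length w * (3 + 2) + 1)
      (?S (length w))"
  proof (rule runs_While_Not)
    show "runs w (Inc 0 ;; Inc d) (?S j) 3 (?S (Suc j))" for j
      by (rule runs_cong[OF runs_Seq[OF runs_Inc runs_Inc]]) (use zero in \<open>auto simp: fun_eq_iff\<close>)
  qed (use zero in auto)
  from runs_Seq[OF start runs_Seq[OF scan runs_clear[of w 0]]]
  show "runs w (Inc 0 ;; While_Not 0 0 (Inc 0 ;; Inc d) ;; clear 0) s (poly [:9, 9:] B)
      (s(d := length w))"
    by (rule runs_cong) (use zero len in \<open>auto simp: fun_eq_iff\<close>)
qed

lemma poly_computable_add:
  assumes "poly_computable f" "poly_computable g"
  shows "poly_computable (\<lambda>w e. f w e + g w e)"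
proof -
  obtain code_f p code_g q where f: "computes code_f p f" and g: "computes code_g q g"
    using assms unfolding poly_computable_def by blast
  let ?code = "\<lambda>\<rho> d. code_f \<rho> d ;; code_g \<rho> (Suc d) ;; add_into (Suc d) d"
  show ?thesis
  proof (rule poly_computableI)
    fix w B \<rho> d e s assume stored: "stores w B \<rho> d e s"
    show "f w e + g w e \<le> poly (p + 6 * q + 3) B"
      using computes_le[OF f stored] computes_le[OF g stored] by simp
    note computes_runs[OF g stores_push[OF stored]]
    from runs_Seq[OF computes_runs[OF f stored] runs_Seq[OF this runs_add_into[of "Suc d" d]]]
    show "runs w (?code \<rho> d) s (poly (p + 6 * q + 3) B) (s(d := f w e + g w e))"
      by (rule runs_cong)
         (use computes_le[OF g stored] stores_free[OF stored] in \<open>auto simp: fun_eq_iff\<close>)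
  qed
qed

text \<open>The argument \<open>v\<close> is passed in register \<open>d\<close>, and the result is returned in the next one.\<close>

definition poly_computable_family :: "(bool list \<Rightarrow> (nat \<Rightarrow> nat) \<Rightarrow> nat \<Rightarrow> nat) \<Rightarrow> bool" where
  "poly_computable_family g \<longleftrightarrow> (\<exists>code p. \<forall>w B \<rho> d e s v. stores w B \<rho> d e s \<longrightarrow> v \<le> B \<longrightarrow>
     g w e v \<le> poly p B \<and>
     runs w (code \<rho> d) (s(d := v)) (poly p B) (s(d := v, Suc d := g w e v)))"

lemma poly_computable_familyI:
  assumes "\<And>w B \<rho> d e s v. stores w B \<rho> d e s \<Longrightarrow> v \<le> B \<Longrightarrow> g w e v \<le> poly p B"
    and "\<And>w B \<rho> d e s v. stores w B \<rho> d e s \<Longrightarrow> v \<le> B \<Longrightarrow>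
      runs w (code \<rho> d) (s(d := v)) (poly p B) (s(d := v, Suc d := g w e v))"
  shows "poly_computable_family g"
  using assms unfolding poly_computable_family_def by blast

lemma poly_computable_family_const:
  assumes "poly_computable g"
  shows "poly_computable_family (\<lambda>w e v. g w e)"
proof -
  obtain code p where g: "computes code p g"
    using assms unfolding poly_computable_def by blast
  show ?thesis
    by (rule poly_computable_familyI[where code = "\<lambda>\<rho> d. code \<rho> (Suc d)"])
       (rule computes_le[OF g] computes_runs[OF g stores_push]; assumption)+
qed

lemma poly_computable_family_bind:
  assumes "poly_computable g"
  shows "poly_computable_family (\<lambda>w e v. g w (e(x := v)))"
proof -
  obtain code p where g: "computes code p g"
    using assms unfolding poly_computable_def by blast
  show ?thesis
    by (rule poly_computable_familyI[where code = "\<lambda>\<rho> d. code (\<rho>(x := d)) (Suc d)"])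
       (rule computes_le[OF g stores_bind] computes_runs[OF g stores_bind]; assumption)+
qed

lemma poly_computable_family_poly_argument:
  assumes "poly_computable_family g"
  shows "\<exists>code p. \<forall>w B \<rho> d e s v. stores w B \<rho> d e s \<longrightarrow> v \<le> poly q B \<longrightarrow>
    g w e v \<le> poly p B \<and>
    runs w (code \<rho> d) (s(d := v)) (poly p B) (s(d := v, Suc d := g w e v))"
proof -
  obtain code p where g: "\<And>w B \<rho> d e s v. stores w B \<rho> d e s \<Longrightarrow> v \<le> B \<Longrightarrow> g w e v \<le> poly p B \<and>
      runs w (code \<rho> d) (s(d := v)) (poly p B) (s(d := v, Suc d := g w e v))"
    using assms unfolding poly_computable_family_def by blast
  let ?p = "pcompose p ([:0, 1:] + q)"
  have "g w e v \<le> poly ?p B \<and>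
      runs w (code \<rho> d) (s(d := v)) (poly ?p B) (s(d := v, Suc d := g w e v))"
    if "stores w B \<rho> d e s" "v \<le> poly q B" for w B \<rho> d e s v
    using g[OF stores_mono[OF that(1)], of "B + poly q B" v] that(2) by (simp add: poly_pcompose)
  then show ?thesis
    by blast
qed

lemma runs_sum_loop:
  assumes code: "\<And>j v. j < n \<Longrightarrow> runs w c (s(d := v, r := j)) t (s(d := v, r := j, x := h j))"
    and h: "\<And>j. j < n \<Longrightarrow> h j \<le> b"
    and registers: "d \<noteq> r" "d \<noteq> x" "r \<noteq> x" "s d = 0" "s x = 0"
  shows "runs w (For r (c ;; add_into x d)) (s(r := n)) (n * (t + 5 * b + 6) + 1)
    (s(d := \<Sum>j < n. h j, r := 0))"
proof -
  let ?I = "\<lambda>j. s(d := \<Sum>v = j..<n. h v)"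
  have "runs w (For r (c ;; add_into x d)) ((?I n)(r := n)) (n * (t + 5 * b + 2 + 4) + 1)
      ((?I 0)(r := 0))"
  proof (rule runs_For)
    fix j assume j: "j < n"
    from runs_Seq[OF code[OF j] runs_add_into[of x d]]
    show "runs w (c ;; add_into x d) ((?I (Suc j))(r := j)) (t + 5 * b + 2) ((?I j)(r := j))"
      by (rule runs_cong)
         (use registers h[OF j] j in \<open>auto simp: fun_eq_iff sum.atLeast_Suc_lessThan\<close>)
  qed
  moreover have "(?I n)(r := n) = s(r := n)"
    using registers by (auto simp: fun_eq_iff)
  ultimately show ?thesis
    by (simp add: lessThan_atLeast0 add.commute)
qed

lemma poly_computable_sum:
  assumes "poly_computable f" "poly_computable_family g"
  shows "poly_computable (\<lambda>w e. \<Sum>v < f w e. g w e v)"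
proof -
  obtain code_f q where f: "computes code_f q f"
    using assms(1) unfolding poly_computable_def by blast
  obtain code_g p where g:
      "\<And>w B \<rho> d e s v. stores w B \<rho> d e s \<Longrightarrow> v \<le> poly q B \<Longrightarrow> g w e v \<le> poly p B"
      "\<And>w B \<rho> d e s v. stores w B \<rho> d e s \<Longrightarrow> v \<le> poly q B \<Longrightarrow>
        runs w (code_g \<rho> d) (s(d := v)) (poly p B) (s(d := v, Suc d := g w e v))"
    using poly_computable_family_poly_argument[OF assms(2), of q] by blast
  let ?loop = "\<lambda>\<rho> d. For (Suc d) (code_g \<rho> (Suc d) ;; add_into (Suc (Suc d)) d)"
  show ?thesis
  proof (rule poly_computableI)
    fix w B \<rho> d e s assume stored: "stores w B \<rho> d e s"
    let ?u = "f w e" and ?b = "poly p B"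
    have u: "?u \<le> poly q B"
      using computes_le[OF f stored] .
    have g_le: "g w e v \<le> ?b" if "v < ?u" for v
      using g(1)[OF stored] that u by simp
    have "(\<Sum>v < ?u. g w e v) \<le> ?u * ?b"
      using sum_bounded_above[of "{..<?u}" "g w e" ?b] g_le by simp
    also have "\<dots> \<le> poly q B * ?b"
      using u by (rule mult_le_mono1)
    finally show "(\<Sum>v < ?u. g w e v) \<le> poly (q + q * (6 * p + 6) + 2) B"
      by (simp add: algebra_simps)
    have free: "s d = 0" "s (Suc d) = 0" "s (Suc (Suc d)) = 0"
      using stores_free[OF stored] by simp_all
    have code_f: "runs w (code_f \<rho> (Suc d)) s (poly q B) (s(Suc d := ?u))"
      using computes_runs[OF f stores_push[OF stored, of 0]] free by (simp add: fun_upd_idem)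
    have loop: "runs w (?loop \<rho> d) (s(Suc d := ?u)) (?u * (?b + 5 * ?b + 6) + 1)
        (s(d := \<Sum>v < ?u. g w e v, Suc d := 0))"
      by (rule runs_sum_loop[OF g(2)[OF stores_push[OF stored]] g_le]) (use free u in auto)
    from runs_Seq[OF code_f loop]
    show "runs w (code_f \<rho> (Suc d) ;; ?loop \<rho> d) s (poly (q + q * (6 * p + 6) + 2) B)
        (s(d := \<Sum>v < ?u. g w e v))"
      by (rule runs_cong)
         (use free mult_le_mono1[OF u, of "6 * ?b + 6"] in \<open>auto simp: fun_eq_iff\<close>)
  qed
qed

lemma poly_computable_mult:
  assumes "poly_computable f" "poly_computable g"
  shows "poly_computable (\<lambda>w e. f w e * g w e)"
  using poly_computable_sum[OF assms(1) poly_computable_family_const[OF assms(2)]] by simp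

definition bit_at :: "bool list \<Rightarrow> nat \<Rightarrow> bool" where
  "bit_at w p \<longleftrightarrow> p < length w \<and> w ! p"

lemma poly_decidable_bit_at:
  assumes "poly_computable f"
  shows "poly_decidable (\<lambda>w e. bit_at w (f w e))"
proof -
  obtain code p where f: "computes code p f"
    using assms unfolding poly_computable_def by blast
  let ?code = "\<lambda>\<rho> d. code \<rho> d ;; add_into d 0 ;; Inc 0 ;; If_Sym 0 2 (Inc d) Skip ;; clear 0"
  show ?thesis
  proof (rule poly_decidableI)
    fix w B \<rho> d e s assume stored: "stores w B \<rho> d e s"
    then have zero: "s d = 0" "s 0 = 0" "0 < d"
      by (auto simp: stores_def)
    let ?u = "f w e" and ?b = "of_bool (bit_at w (f w e))"
    have load: "runs w (add_into d 0) (s(d := ?u)) (?u * 5 + 1) (s(0 := ?u))"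
      by (rule runs_cong[OF runs_add_into]) (use zero in \<open>auto simp: fun_eq_iff\<close>)
    have shift: "runs w (Inc 0) (s(0 := ?u)) 1 (s(0 := Suc ?u))"
      by (rule runs_cong[OF runs_Inc]) auto
    have test: "runs w (If_Sym 0 2 (Inc d) Skip) (s(0 := Suc ?u)) (1 + 1) (s(0 := Suc ?u, d := ?b))"
      by (rule runs_If_Sym, rule runs_cong[OF runs_Inc])
         (use zero in \<open>auto simp: fun_eq_iff bit_at_def\<close>)
    have unload: "runs w (clear 0) (s(0 := Suc ?u, d := ?b)) (Suc ?u * 4 + 1) (s(d := ?b))"
      by (rule runs_cong[OF runs_clear]) (use zero in \<open>auto simp: fun_eq_iff\<close>)
    from runs_Seq[OF computes_runs[OF f stored]
        runs_Seq[OF load runs_Seq[OF shift runs_Seq[OF test unload]]]]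
    show "runs w (?code \<rho> d) s (poly (10 * p + 13) B) (s(d := ?b))"
      by (rule runs_mono) (use computes_le[OF f stored] in simp)
  qed
qed

lemma poly_decidable_less:
  assumes "poly_computable f" "poly_computable g"
  shows "poly_decidable (\<lambda>w e. f w e < g w e)"
proof -
  obtain code_f p code_g q where f: "computes code_f p f" and g: "computes code_g q g"
    using assms unfolding poly_computable_def by blast
  let ?test = "\<lambda>d. If_Sym (Suc d) 3 Skip (clear (Suc d) ;; Inc d)"
  let ?code = "\<lambda>\<rho> d. code_f \<rho> d ;; code_g \<rho> (Suc d) ;; subtract_from d (Suc d) ;; ?test d"
  show ?thesis
  proof (rule poly_decidableI)
    fix w B \<rho> d e s assume stored: "stores w B \<rho> d e s"
    let ?u = "f w e" and ?v = "g w e"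
    let ?diff = "s(Suc d := ?v - ?u)" and ?answer = "s(d := of_bool (?u < ?v))"
    have free: "s d = 0" "s (Suc d) = 0"
      using stores_free[OF stored] by simp_all
    have subtract: "runs w (subtract_from d (Suc d)) (s(d := ?u, Suc d := ?v)) (?u * 5 + 1) ?diff"
      by (rule runs_cong[OF runs_subtract_from]) (use free in \<open>auto simp: fun_eq_iff\<close>)
    have test: "runs w (?test d) ?diff (?v * 4 + 3 + 1) ?answer"
    proof (rule runs_If_Sym)
      assume "register_symbol w (Suc d) (?diff (Suc d)) = 3"
      then show "runs w Skip ?diff (?v * 4 + 3) ?answer"
        using free by (auto simp: fun_eq_iff)
    next
      assume "register_symbol w (Suc d) (?diff (Suc d)) \<noteq> 3"
      then show "runs w (clear (Suc d) ;; Inc d) ?diff (?v * 4 + 3) ?answer"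
        using free by (intro runs_cong[OF runs_Seq[OF runs_clear runs_Inc]]) (auto simp: fun_eq_iff)
    qed
    note computes_runs[OF g stores_push[OF stored]]
    from runs_Seq[OF computes_runs[OF f stored] runs_Seq[OF this runs_Seq[OF subtract test]]]
    show "runs w (?code \<rho> d) s (poly (6 * p + 5 * q + 8) B) ?answer"
      by (rule runs_mono) (use computes_le[OF f stored] computes_le[OF g stored] in simp)
  qed
qed

lemma poly_decidable_not:
  assumes "poly_decidable P"
  shows "poly_decidable (\<lambda>w e. \<not> P w e)"
  using poly_decidable_less[OF assms[unfolded poly_decidable_def] poly_computable_const[of 1]]
  by simp

lemma poly_decidable_conj:
  assumes "poly_decidable P" "poly_decidable Q"
  shows "poly_decidable (\<lambda>w e. P w e \<and> Q w e)"
  using poly_computable_mult[OF assms[unfolded poly_decidable_def]]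
  by (simp add: poly_decidable_def of_bool_conj)

lemma poly_decidable_ex:
  assumes "poly_computable f" "poly_decidable P"
  shows "poly_decidable (\<lambda>w e. \<exists>v < f w e. P w (e(x := v)))"
proof -
  have "poly_computable (\<lambda>w e. \<Sum>v < f w e. of_bool (P w (e(x := v))))"
    using assms poly_computable_family_bind unfolding poly_decidable_def
    by (intro poly_computable_sum)
  from poly_decidable_less[OF poly_computable_0 this] show ?thesis
    by (simp add: zero_less_iff_neq_zero Bex_def del: sum_of_bool_eq)
qed

theorem poly_decidable_in_class_P:
  assumes "poly_decidable P"
  shows "{w. P w (\<lambda>_. 0)} \<in> class_P"
proof -
  obtain code p where P: "computes code p (\<lambda>w e. of_bool (P w e))"
    using assms unfolding poly_decidable_def poly_computable_def by blast
  show ?thesis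
  proof (rule program_in_class_P)
    fix w
    have "stores w (length w) (\<lambda>_. 0) 1 (\<lambda>_. 0) (\<lambda>_. 0)"
      by (simp add: stores_def)
    from computes_runs[OF P this]
    show "\<exists>s. runs w (code (\<lambda>_. 0) 1) (\<lambda>_. 0) (poly p (length w)) s \<and>
        (s 1 \<noteq> 0 \<longleftrightarrow> w \<in> {w. P w (\<lambda>_. 0)})"
      by (intro exI conjI) (assumption, simp)
  qed
qed

section \<open>Existential second-order logic\<close>

datatype fo = Rel nat nat nat | Eq nat nat | Neg fo | And fo fo | Exists nat fo

fun fo_sat :: "nat \<Rightarrow> (nat \<Rightarrow> nat \<Rightarrow> nat \<Rightarrow> bool) \<Rightarrow> (nat \<Rightarrow> nat) \<Rightarrow> fo \<Rightarrow> bool" where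
  "fo_sat n R e (Rel r x y) \<longleftrightarrow> R r (e x) (e y)"
| "fo_sat n R e (Eq x y) \<longleftrightarrow> e x = e y"
| "fo_sat n R e (Neg \<phi>) \<longleftrightarrow> \<not> fo_sat n R e \<phi>"
| "fo_sat n R e (And \<phi> \<psi>) \<longleftrightarrow> fo_sat n R e \<phi> \<and> fo_sat n R e \<psi>"
| "fo_sat n R e (Exists x \<phi>) \<longleftrightarrow> (\<exists>v < n. fo_sat n R (e(x := v)) \<phi>)"

fun rel_bound :: "fo \<Rightarrow> nat" where
  "rel_bound (Rel r x y) = Suc r"
| "rel_bound (Eq x y) = 0"
| "rel_bound (Neg \<phi>) = rel_bound \<phi>"
| "rel_bound (And \<phi> \<psi>) = max (rel_bound \<phi>) (rel_bound \<psi>)"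
| "rel_bound (Exists x \<phi>) = rel_bound \<phi>"

lemma fo_sat_cong:
  assumes "\<And>r i j. r < rel_bound \<phi> \<Longrightarrow> i < n \<Longrightarrow> j < n \<Longrightarrow> R r i j \<longleftrightarrow> R' r i j" "\<And>x. e x < n"
  shows "fo_sat n R e \<phi> \<longleftrightarrow> fo_sat n R' e \<phi>"
  using assms
proof (induction \<phi> arbitrary: e)
  case (Exists x \<phi>)
  then have "fo_sat n R (e(x := v)) \<phi> \<longleftrightarrow> fo_sat n R' (e(x := v)) \<phi>" if "v < n" for v
    using that by simp
  then show ?case
    by auto
qed auto

definition digraph_of :: "nat \<Rightarrow> (nat \<Rightarrow> nat \<Rightarrow> bool) \<Rightarrow> nat pair_pre_digraph" where
  "digraph_of n E = \<lparr>pverts = {..<n}, parcs = {(i, j). i < n \<and> j < n \<and> E i j}\<rparr>"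

lemma pverts_digraph_of [simp]: "pverts (digraph_of n E) = {..<n}"
  and parcs_digraph_of [simp]: "(i, j) \<in> parcs (digraph_of n E) \<longleftrightarrow> i < n \<and> j < n \<and> E i j"
  by (simp_all add: digraph_of_def)

lemma matrix_index_less: "i < m \<Longrightarrow> j < n \<Longrightarrow> i * n + j < m * (n :: nat)"
  by (metis add.commute add_less_cancel_left less_le_trans mult.commute mult_Suc_right
      mult_le_mono2 Suc_leI)

lemma eq_adjacency_code_digraph_of_iff:
  "x = adjacency_code (digraph_of n E) \<longleftrightarrow>
    length x = n * n \<and> (\<forall>i < n. \<forall>j < n. x ! (i * n + j) \<longleftrightarrow> E i j)"
proof -
  let ?c = "adjacency_code (digraph_of n E)"
  have length: "length ?c = n * n"
    by (simp add: adjacency_code_def)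
  have div_mod_less: "p div n < n" "p mod n < n" if "p < n * n" for p
    using that by (cases n; simp add: less_mult_imp_div_less)+
  have nth: "?c ! p \<longleftrightarrow> E (p div n) (p mod n)" if "p < n * n" for p
    using that div_mod_less[OF that] by (simp add: adjacency_code_def product_nth)
  show ?thesis
  proof
    assume "x = ?c"
    then show "length x = n * n \<and> (\<forall>i < n. \<forall>j < n. x ! (i * n + j) \<longleftrightarrow> E i j)"
      using nth matrix_index_less[of _ n _ n] by (simp add: length)
  next
    assume x: "length x = n * n \<and> (\<forall>i < n. \<forall>j < n. x ! (i * n + j) \<longleftrightarrow> E i j)"
    show "x = ?c"
    proof (rule nth_equalityI)
      fix p assume "p < length x"
      then have p: "p < n * n"
        using x by simp
      then have "x ! (p div n * n + p mod n) \<longleftrightarrow> E (p div n) (p mod n)"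
        using x div_mod_less by blast
      then show "x ! p \<longleftrightarrow> ?c ! p"
        using nth[OF p] by simp
    qed (simp add: x length)
  qed
qed

text \<open>
  Relation 0 is the input. The union over all \<open>R\<close> plays the role of the second-order quantifiers.
\<close>

definition eso_language :: "fo \<Rightarrow> bool list set" where
  "eso_language \<phi> = {adjacency_code (digraph_of n (R 0)) | n R. 0 < n \<and> fo_sat n R (\<lambda>_. 0) \<phi>}"

definition separator_at :: "bool list \<Rightarrow> nat \<Rightarrow> bool" where
  "separator_at w m \<longleftrightarrow> \<not> bit_at w (2 * m) \<and> bit_at w (2 * m + 1)"

lemma length_word_pair: "length (word_pair x u) = 2 * length x + 2 + length u"
  by (induction x) (auto simp: word_pair_def)

lemma bit_at_word_pair_Cons:
  "bit_at (word_pair (b # x) u) 0 \<longleftrightarrow> b" "bit_at (word_pair (b # x) u) (Suc 0) \<longleftrightarrow> b"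
  "bit_at (word_pair (b # x) u) (Suc (Suc p)) \<longleftrightarrow> bit_at (word_pair x u) p"
  by (simp_all add: bit_at_def word_pair_def)

lemma bit_at_word_pair_Nil:
  "\<not> bit_at (word_pair [] u) 0" "bit_at (word_pair [] u) (Suc 0)"
  "bit_at (word_pair [] u) (Suc (Suc p)) \<longleftrightarrow> bit_at u p"
  by (simp_all add: bit_at_def word_pair_def)

lemma bit_at_word_pair_fst:
  "i < length x \<Longrightarrow> bit_at (word_pair x u) (2 * i) \<longleftrightarrow> x ! i"
  "i < length x \<Longrightarrow> bit_at (word_pair x u) (2 * i + 1) \<longleftrightarrow> x ! i"
proof (induction x arbitrary: i)
  case (Cons b x)
  case 1
  then show ?case using Cons.IH(1) by (cases i) (simp_all add: bit_at_word_pair_Cons)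
  case 2
  then show ?case using Cons.IH(2) by (cases i) (simp_all add: bit_at_word_pair_Cons)
qed simp_all

lemma bit_at_word_pair_snd: "bit_at (word_pair x u) (2 * length x + 2 + p) \<longleftrightarrow> bit_at u p"
  by (induction x) (simp_all add: bit_at_word_pair_Cons bit_at_word_pair_Nil)

lemma separator_at_word_pair: "separator_at (word_pair x u) (length x)"
  by (induction x) (simp_all add: separator_at_def bit_at_word_pair_Cons bit_at_word_pair_Nil)

lemma first_separator_word_pair_iff:
  "separator_at (word_pair x u) m \<and> (\<forall>i < m. \<not> separator_at (word_pair x u) i) \<longleftrightarrow> m = length x"
proof -
  have "\<not> separator_at (word_pair x u) i" if "i < length x" for i
    using bit_at_word_pair_fst[OF that, of u] by (simp add: separator_at_def)
  then show ?thesis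
    using separator_at_word_pair[of x u] by (metis linorder_neqE_nat)
qed

lemma poly_decidable_separator_at:
  "poly_computable f \<Longrightarrow> poly_decidable (\<lambda>w e. separator_at w (f w e))"
  unfolding separator_at_def
  by (intro poly_decidable_conj poly_decidable_not poly_decidable_bit_at poly_computable_add
      poly_computable_mult poly_computable_const)

text \<open>
  In \<open>word_pair x u\<close> the bits of the \<open>n \<times> n\<close> matrix \<open>x\<close> are doubled; \<open>u\<close> is the sequence of the
  matrices of all other relations.
\<close>

fun encoded_rel :: "bool list \<Rightarrow> nat \<Rightarrow> nat \<Rightarrow> nat \<Rightarrow> nat \<Rightarrow> bool" where
  "encoded_rel w n 0 i j \<longleftrightarrow> bit_at w (2 * (i * n + j))"
| "encoded_rel w n (Suc r) i j \<longleftrightarrow> bit_at w (2 * (n * n) + 2 + (r * (n * n) + (i * n + j)))"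

lemma encoded_rel_word_pair:
  assumes "length x = n * n"
  shows "i < n \<Longrightarrow> j < n \<Longrightarrow> encoded_rel (word_pair x u) n 0 i j \<longleftrightarrow> x ! (i * n + j)"
    and "encoded_rel (word_pair x u) n (Suc r) i j \<longleftrightarrow> bit_at u (r * (n * n) + (i * n + j))"
  using matrix_index_less[of i n j n] bit_at_word_pair_fst(1)[of "i * n + j" x u]
    bit_at_word_pair_snd[of x u "r * (n * n) + (i * n + j)"]
  by (simp_all add: assms)

definition relation_bits :: "nat \<Rightarrow> nat \<Rightarrow> (nat \<Rightarrow> nat \<Rightarrow> nat \<Rightarrow> bool) \<Rightarrow> bool list" where
  "relation_bits m n R =
     map (\<lambda>p. R (p div (n * n)) (p mod (n * n) div n) (p mod n)) [0..<m * (n * n)]"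

lemma bit_at_relation_bits:
  assumes "r < m" "i < n" "j < n"
  shows "bit_at (relation_bits m n R) (r * (n * n) + (i * n + j)) \<longleftrightarrow> R r i j"
proof -
  let ?p = "r * (n * n) + (i * n + j)"
  have index: "i * n + j < n * n"
    using assms(2,3) by (rule matrix_index_less)
  have "?p < m * (n * n)"
    using assms(1) index by (rule matrix_index_less)
  moreover have "?p div (n * n) = r" "?p mod (n * n) = i * n + j"
    using index assms by simp_all
  moreover have "?p mod n = (i * n + j) mod n"
    by (metis mod_mod_cancel dvd_triv_left calculation(3))
  ultimately show ?thesis
    using assms by (simp add: bit_at_def relation_bits_def)
qed

lemma poly_decidable_fo_sat:
  "poly_decidable (\<lambda>w e. fo_sat (e 0) (encoded_rel w (e 0)) (\<lambda>x. e (Suc x)) \<phi>)"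
proof (induction \<phi>)
  case (Rel r x y)
  show ?case
    by (cases r; simp only: fo_sat.simps encoded_rel.simps)
       (intro poly_decidable_bit_at poly_computable_add poly_computable_mult
         poly_computable_const poly_computable_var)+
next
  case (Eq x y)
  have "poly_decidable (\<lambda>w e. \<not> e (Suc x) < e (Suc y) \<and> \<not> e (Suc y) < e (Suc x))"
    by (intro poly_decidable_conj poly_decidable_not poly_decidable_less poly_computable_var)
  moreover have "\<not> a < b \<and> \<not> b < a \<longleftrightarrow> a = b" for a b :: nat
    by auto
  ultimately show ?case
    by simp
next
  case (Exists x \<phi>)
  have "(\<lambda>y. (e(Suc x := v)) (Suc y)) = (\<lambda>y. e (Suc y))(x := v)" for e :: "nat \<Rightarrow> nat" and v
    by (simp add: fun_eq_iff)
  then show ?case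
    using poly_decidable_ex[OF poly_computable_var[of 0] Exists.IH, of "Suc x"] by simp
qed (auto intro: poly_decidable_not poly_decidable_conj)

definition eso_verifier :: "fo \<Rightarrow> bool list set" where
  "eso_verifier \<phi> = {w. \<exists>n < length w. 0 < n \<and>
     (separator_at w (n * n) \<and> (\<forall>i < n * n. \<not> separator_at w i)) \<and>
     fo_sat n (encoded_rel w n) (\<lambda>_. 0) \<phi>}"

lemma eso_verifier_in_class_P: "eso_verifier \<phi> \<in> class_P"
proof -
  have "poly_decidable (\<lambda>w e. \<exists>i < e 0 * e 0. separator_at w ((e(1 := i)) 1))"
    by (intro poly_decidable_ex poly_decidable_separator_at poly_computable_mult
        poly_computable_var)
  then have "poly_decidable (\<lambda>w e. 0 < e 0 \<and>
      (separator_at w (e 0 * e 0) \<and> \<not> (\<exists>i < e 0 * e 0. separator_at w i)) \<and>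
      fo_sat (e 0) (encoded_rel w (e 0)) (\<lambda>x. e (Suc x)) \<phi>)"
    by (intro poly_decidable_conj poly_decidable_less poly_decidable_not poly_decidable_fo_sat
        poly_decidable_separator_at poly_computable_mult poly_computable_var poly_computable_const)
       simp
  from poly_decidable_in_class_P[OF poly_decidable_ex[OF poly_computable_length this, of 0]]
  show ?thesis
    by (simp add: eso_verifier_def)
qed

lemma word_pair_in_eso_verifier_iff:
  "word_pair x u \<in> eso_verifier \<phi> \<longleftrightarrow>
    (\<exists>n. 0 < n \<and> length x = n * n \<and> fo_sat n (encoded_rel (word_pair x u) n) (\<lambda>_. 0) \<phi>)"
proof -
  have "n < length (word_pair x u)" if "length x = n * n" for n
    using that le_less_trans[OF le_square[of n], of "length (word_pair x u)"]
    by (simp add: length_word_pair)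
  then show ?thesis
    unfolding eso_verifier_def mem_Collect_eq first_separator_word_pair_iff by metis
qed

text \<open>The easy direction of Fagin's theorem, for directed graphs.\<close>

theorem eso_language_in_class_NP: "eso_language \<phi> \<in> class_NP"
proof -
  let ?m = "rel_bound \<phi>"
  have "x \<in> eso_language \<phi> \<longleftrightarrow>
      (\<exists>u. length u \<le> poly [:0, ?m:] (length x) \<and> word_pair x u \<in> eso_verifier \<phi>)" for x
  proof
    assume "x \<in> eso_language \<phi>"
    then obtain n R where n: "0 < n" and sat: "fo_sat n R (\<lambda>_. 0) \<phi>"
        and x: "length x = n * n" "\<forall>i < n. \<forall>j < n. x ! (i * n + j) \<longleftrightarrow> R 0 i j"
      unfolding eso_language_def mem_Collect_eq eq_adjacency_code_digraph_of_iff by blast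
    define u where "u = relation_bits ?m n (\<lambda>r. R (Suc r))"
    have "encoded_rel (word_pair x u) n r i j \<longleftrightarrow> R r i j" if "r < ?m" "i < n" "j < n" for r i j
      using that x by (cases r) (simp_all add: encoded_rel_word_pair bit_at_relation_bits u_def
          del: encoded_rel.simps)
    then have "fo_sat n (encoded_rel (word_pair x u) n) (\<lambda>_. 0) \<phi>"
      using sat fo_sat_cong[of \<phi> n "encoded_rel (word_pair x u) n" R "\<lambda>_. 0"] n by simp
    then have "word_pair x u \<in> eso_verifier \<phi>"
      unfolding word_pair_in_eso_verifier_iff using n x(1) by blast
    moreover have "length u \<le> poly [:0, ?m:] (length x)"
      by (simp add: u_def relation_bits_def x(1) mult.commute)
    ultimately show "\<exists>u. length u \<le> poly [:0, ?m:] (length x) \<and> word_pair x u \<in> eso_verifier \<phi>"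
      by blast
  next
    assume "\<exists>u. length u \<le> poly [:0, ?m:] (length x) \<and> word_pair x u \<in> eso_verifier \<phi>"
    then obtain u n where "0 < n" "length x = n * n"
        "fo_sat n (encoded_rel (word_pair x u) n) (\<lambda>_. 0) \<phi>"
      unfolding word_pair_in_eso_verifier_iff by blast
    moreover from this have "x = adjacency_code (digraph_of n (encoded_rel (word_pair x u) n 0))"
      unfolding eq_adjacency_code_digraph_of_iff
      by (simp add: encoded_rel_word_pair del: encoded_rel.simps)
    ultimately show "x \<in> eso_language \<phi>"
      unfolding eso_language_def by blast
  qed
  then show ?thesis
    unfolding class_NP_def using eso_verifier_in_class_P by blast
qed

section \<open>Induced subgraphs\<close>

definition induced_embedding ::
    "'b pair_pre_digraph \<Rightarrow> 'a pair_pre_digraph \<Rightarrow> ('b \<Rightarrow> 'a) \<Rightarrow> bool" where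
  "induced_embedding H G f \<longleftrightarrow> f ` pverts H \<subseteq> pverts G \<and> inj_on f (pverts H) \<and>
     (\<forall>i \<in> pverts H. \<forall>j \<in> pverts H. (f i, f j) \<in> parcs G \<longleftrightarrow> (i, j) \<in> parcs H)"

lemma (in pair_wf_digraph) parcs_subset: "parcs G \<subseteq> pverts G \<times> pverts G"
  by (auto dest: in_arcsD1 in_arcsD2)

lemma induced_embedding_if_digraph_iso:
  assumes "digraph_iso (with_proj A) (with_proj B)"
  obtains f where "induced_embedding A B f" "f ` pverts A = pverts B"
proof -
  obtain hom where hom: "pre_digraph.digraph_isomorphism (with_proj A) hom"
    and B: "with_proj B = app_iso hom (with_proj A)"
    using assms unfolding digraph_iso_def by blast
  let ?f = "iso_verts hom"
  have wf: "wf_digraph (with_proj A)" and inj: "inj_on ?f (pverts A)"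
    using hom by (simp_all add: pre_digraph.digraph_isomorphism_def)
  have verts: "?f ` pverts A = pverts B"
    using arg_cong[OF B, of verts] by simp
  have arcs: "parcs B = (\<lambda>(u, v). (?f u, ?f v)) ` parcs A"
    using wf_digraph.arcs_ends_app_iso_eq[OF wf hom] unfolding B[symmetric] with_proj_simps .
  have "(?f i, ?f j) \<in> parcs B \<longleftrightarrow> (i, j) \<in> parcs A" if "i \<in> pverts A" "j \<in> pverts A" for i j
  proof
    assume "(?f i, ?f j) \<in> parcs B"
    then obtain k l where kl: "(k, l) \<in> parcs A" "?f k = ?f i" "?f l = ?f j"
      unfolding arcs by auto
    moreover have "k \<in> pverts A" "l \<in> pverts A"
      using pair_wf_digraph.parcs_subset[of A] wf kl(1) by (auto simp: wf_digraph_wp_iff)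
    ultimately show "(i, j) \<in> parcs A"
      using that inj by (metis inj_onD)
  qed (auto simp: arcs)
  then show thesis
    using that[of ?f] inj verts by (simp add: induced_embedding_def)
qed

lemma digraph_iso_if_induced_embedding:
  assumes A: "pair_wf_digraph A" and B: "pair_wf_digraph B"
    and f: "induced_embedding A B f" "f ` pverts A = pverts B"
  shows "digraph_iso (with_proj A) (with_proj B)"
proof -
  let ?hom = "\<lparr>iso_verts = f, iso_arcs = map_prod f f, iso_head = snd, iso_tail = fst\<rparr>"
  have inj: "inj_on f (pverts A)"
    and arc_iff: "\<And>i j. i \<in> pverts A \<Longrightarrow> j \<in> pverts A \<Longrightarrow> (f i, f j) \<in> parcs B \<longleftrightarrow> (i, j) \<in> parcs A"
    using f(1) by (simp_all add: induced_embedding_def)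
  have A_arcs: "parcs A \<subseteq> pverts A \<times> pverts A" and B_arcs: "parcs B \<subseteq> pverts B \<times> pverts B"
    using A B by (simp_all add: pair_wf_digraph.parcs_subset)
  have "parcs B = map_prod f f ` parcs A"
  proof (intro equalityI subrelI)
    fix u v assume "(u, v) \<in> parcs B"
    moreover from this obtain i j where "i \<in> pverts A" "j \<in> pverts A" "u = f i" "v = f j"
      using B_arcs f(2) by blast
    ultimately show "(u, v) \<in> map_prod f f ` parcs A"
      using arc_iff by (intro image_eqI[of _ _ "(i, j)"]) auto
  qed (use A_arcs arc_iff in auto)
  then have "with_proj B = app_iso ?hom (with_proj A)"
    by (simp add: app_iso_def with_proj_def f(2))
  moreover have "inj_on (map_prod f f) (parcs A)"
    using map_prod_inj_on[OF inj inj] A_arcs by (rule inj_on_subset)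
  then have "pre_digraph.digraph_isomorphism (with_proj A) ?hom"
    using A inj by (simp add: pre_digraph.digraph_isomorphism_def wf_digraph_wp_iff)
  ultimately show ?thesis
    unfolding digraph_iso_def by blast
qed

definition pair_induced :: "'a pair_pre_digraph \<Rightarrow> 'a set \<Rightarrow> 'a pair_pre_digraph" where
  "pair_induced G W = \<lparr>pverts = W, parcs = parcs G \<inter> W \<times> W\<rparr>"

lemma pair_induced_simps [simp]:
  "pverts (pair_induced G W) = W" "parcs (pair_induced G W) = parcs G \<inter> W \<times> W"
  by (simp_all add: pair_induced_def)

lemma pair_wf_digraph_pair_induced: "pair_wf_digraph (pair_induced G W)"
  by unfold_locales auto

lemma with_proj_pair_induced: "with_proj G \<restriction> W = with_proj (pair_induced G W)"
  by (auto simp: induce_subgraph_def with_proj_def)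

lemma induced_free_iff:
  assumes H: "pair_wf_digraph H"
  shows "induced_free (with_proj H) (with_proj G) \<longleftrightarrow> (\<nexists>f. induced_embedding H G f)"
proof -
  have "(\<exists>W \<subseteq> pverts G. digraph_iso (with_proj (pair_induced G W)) (with_proj H)) \<longleftrightarrow>
      (\<exists>f. induced_embedding H G f)"
  proof
    assume "\<exists>W \<subseteq> pverts G. digraph_iso (with_proj (pair_induced G W)) (with_proj H)"
    then obtain W where "W \<subseteq> pverts G" "digraph_iso (with_proj (pair_induced G W)) (with_proj H)"
      by blast
    then have "digraph_iso (with_proj H) (with_proj (pair_induced G W))"
      using digraph_iso_swap pair_wf_digraph_pair_induced wf_digraph_wp_iff by blast
    then obtain f where "induced_embedding H (pair_induced G W) f"
      by (rule induced_embedding_if_digraph_iso)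
    then have "induced_embedding H G f"
      using \<open>W \<subseteq> pverts G\<close> by (auto simp: induced_embedding_def image_subset_iff)
    then show "\<exists>f. induced_embedding H G f"
      by blast
  next
    assume "\<exists>f. induced_embedding H G f"
    then obtain f where f: "induced_embedding H G f"
      by blast
    let ?A = "pair_induced G (f ` pverts H)"
    have "induced_embedding H ?A f" "f ` pverts H = pverts ?A"
      using f by (auto simp: induced_embedding_def)
    then have "digraph_iso (with_proj H) (with_proj ?A)"
      using H pair_wf_digraph_pair_induced by (intro digraph_iso_if_induced_embedding)
    then have "digraph_iso (with_proj ?A) (with_proj H)"
      by (rule digraph_iso_swap[rotated]) (simp add: wf_digraph_wp_iff H)
    then show "\<exists>W \<subseteq> pverts G. digraph_iso (with_proj (pair_induced G W)) (with_proj H)"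
      using f by (auto simp: induced_embedding_def)
  qed
  then show ?thesis
    unfolding induced_free_def by (simp add: with_proj_pair_induced)
qed

lemma pair_wf_digraph_undirected: "E \<subseteq> V \<times> V \<Longrightarrow> pair_wf_digraph (undirected V E)"
  by unfold_locales (auto simp: undirected_def)

lemma pair_wf_forbidden_graphs:
  "pair_wf_digraph W4_graph" "pair_wf_digraph dart_graph" "pair_wf_digraph gem_graph"
  unfolding W4_graph_def dart_graph_def gem_graph_def
  by (rule pair_wf_digraph_undirected; simp)+

lemma pverts_forbidden_graphs:
  "pverts W4_graph = {..<5}" "pverts dart_graph = {..<5}" "pverts gem_graph = {..<5}"
  by (auto simp: W4_graph_def dart_graph_def gem_graph_def undirected_def)

lemma W4_dart_gem_free_iff:
  "W4_dart_gem_free (with_proj G) \<longleftrightarrow>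
    (\<forall>H \<in> {W4_graph, dart_graph, gem_graph}. \<nexists>f. induced_embedding H G f)"
  by (simp add: W4_dart_gem_free_def induced_free_iff pair_wf_forbidden_graphs)

section \<open>Maximal stars\<close>

definition star_at :: "'a pair_pre_digraph \<Rightarrow> 'a \<Rightarrow> 'a set \<Rightarrow> bool" where
  "star_at G v I \<longleftrightarrow>
     I \<noteq> {} \<and> (\<forall>a \<in> I. (v, a) \<in> parcs G) \<and> (\<forall>a \<in> I. \<forall>b \<in> I. (a, b) \<notin> parcs G)"

definition twins :: "'a pair_pre_digraph \<Rightarrow> 'a \<Rightarrow> 'a \<Rightarrow> bool" where
  "twins G v w \<longleftrightarrow> (v, w) \<in> parcs G \<and>
     (\<forall>b \<in> pverts G. b \<noteq> v \<and> b \<noteq> w \<longrightarrow> ((v, b) \<in> parcs G \<longleftrightarrow> (w, b) \<in> parcs G))"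

text \<open>These are the possible leaves of a star with center \<open>v\<close> and at least two leaves.\<close>

definition proper_leaf :: "'a pair_pre_digraph \<Rightarrow> 'a \<Rightarrow> 'a \<Rightarrow> bool" where
  "proper_leaf G v a \<longleftrightarrow> (v, a) \<in> parcs G \<and>
     (\<exists>b \<in> pverts G. (v, b) \<in> parcs G \<and> b \<noteq> a \<and> (a, b) \<notin> parcs G)"

definition covers_leaves :: "'a pair_pre_digraph \<Rightarrow> 'a \<Rightarrow> 'a set \<Rightarrow> bool" where
  "covers_leaves G v C \<longleftrightarrow> (\<exists>u \<in> pverts G. proper_leaf G v u) \<and>
     (\<forall>u \<in> pverts G. proper_leaf G v u \<longrightarrow>
       (\<exists>w \<in> C. proper_leaf G v w \<and> (w = u \<or> (w, u) \<in> parcs G)))"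

lemma covers_leaves_mono: "covers_leaves G v C \<Longrightarrow> C \<subseteq> D \<Longrightarrow> covers_leaves G v D"
  unfolding covers_leaves_def by blast

context pair_graph
begin

abbreviation adj :: "'a \<Rightarrow> 'a \<Rightarrow> bool" where
  "adj u v \<equiv> (u, v) \<in> parcs G"

lemma adj_sym: "adj u v \<longleftrightarrow> adj v u"
  using arcs_symmetric by blast

lemma adj_irrefl: "\<not> adj v v"
  using no_loops' by blast

lemma adj_verts: "adj u v \<Longrightarrow> u \<in> pverts G \<and> v \<in> pverts G"
  using wellformed' by blast

lemma star_at_iff_arcs:
  "star_at G v I \<longleftrightarrow> I \<noteq> {} \<and> v \<notin> I \<and>
    parcs G \<inter> insert v I \<times> insert v I = {v} \<times> I \<union> I \<times> {v}"
proof
  assume "star_at G v I"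
  then show "I \<noteq> {} \<and> v \<notin> I \<and> parcs G \<inter> insert v I \<times> insert v I = {v} \<times> I \<union> I \<times> {v}"
    using adj_irrefl adj_sym by (auto simp: star_at_def)
next
  assume star: "I \<noteq> {} \<and> v \<notin> I \<and> parcs G \<inter> insert v I \<times> insert v I = {v} \<times> I \<union> I \<times> {v}"
  then have "(a, b) \<in> {v} \<times> I \<union> I \<times> {v}" if "adj a b" "a \<in> I" "b \<in> I" for a b
    using that by blast
  then show "star_at G v I"
    using star by (auto simp: star_at_def)
qed

lemma is_star_iff: "is_star (with_proj G) W \<longleftrightarrow> (\<exists>v I. W = insert v I \<and> star_at G v I)"
proof
  assume "is_star (with_proj G) W"
  then obtain m U I where m: "m \<ge> 1" "card I = m" and W: "W = U \<union> I" "U \<inter> I = {}"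
    and "card U = 1" and arcs: "parcs (pair_induced G W) = U \<times> I \<union> I \<times> U"
    unfolding is_star_def with_proj_pair_induced complete_bipartite_digraph_pair_def by auto
  obtain v where U: "U = {v}"
    using \<open>card U = 1\<close> by (auto simp: card_1_singleton_iff)
  have "I \<noteq> {}"
    using m by auto
  then have "W = insert v I \<and> star_at G v I"
    using W arcs unfolding star_at_iff_arcs U by simp
  then show "\<exists>v I. W = insert v I \<and> star_at G v I"
    by blast
next
  assume "\<exists>v I. W = insert v I \<and> star_at G v I"
  then obtain v I where W: "W = insert v I" "star_at G v I"
    by blast
  have "W \<subseteq> pverts G"
    using W adj_verts unfolding star_at_def by blast
  then have "finite W"
    using pair_finite_verts finite_subset by blast
  have "I \<noteq> {}" "v \<notin> I" and arcs: "parcs (pair_induced G W) = {v} \<times> I \<union> I \<times> {v}"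
    using W(2) unfolding star_at_iff_arcs W(1) by simp_all
  then have "card I \<ge> 1"
    using \<open>finite W\<close> W(1) by (simp add: Suc_le_eq card_gt_0_iff)
  moreover have "pverts (pair_induced G W) = {v} \<union> I" "{v} \<inter> I = {}" "card {v} = 1"
    using W(1) \<open>v \<notin> I\<close> by simp_all
  ultimately show "is_star (with_proj G) W"
    unfolding is_star_def with_proj_pair_induced complete_bipartite_digraph_pair_def
    using \<open>W \<subseteq> pverts G\<close> \<open>finite W\<close> arcs by (metis pair_induced_simps(1) with_proj_simps(1))
qed

lemma is_maximal_star_iff:
  "is_maximal_star (with_proj G) W \<longleftrightarrow> (\<exists>v I. W = insert v I \<and> star_at G v I) \<and>
     (\<forall>c J. star_at G c J \<and> W \<subseteq> insert c J \<longrightarrow> insert c J = W)"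
  unfolding is_maximal_star_def is_star_iff by blast

lemma maximal_starD:
  assumes "is_maximal_star (with_proj G) W" "star_at G c J" "W \<subseteq> insert c J"
  shows "insert c J = W"
  using assms by (simp add: is_maximal_star_iff)

lemma proper_leaf_if_star_at:
  assumes "star_at G v I" "a \<in> I" "b \<in> I" "b \<noteq> a"
  shows "proper_leaf G v a"
  using assms adj_verts unfolding star_at_def proper_leaf_def by blast

lemma twins_if_maximal_star:
  assumes max: "is_maximal_star (with_proj G) {v, w}" and "adj v w"
  shows "twins G v w"
proof -
  have no_extension: "\<not> star_at G x {y, b}" if "{x, y} = {v, w}" "b \<noteq> v" "b \<noteq> w" for x y b
  proof
    assume "star_at G x {y, b}"
    then have "insert x {y, b} = {v, w}"
      by (rule maximal_starD[OF max]) (use that(1) in blast)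
    then show False
      using that(2,3) by blast
  qed
  have "adj w b" if "adj v b" "b \<noteq> w" for b
    using no_extension[of v w b] that \<open>adj v w\<close> adj_irrefl adj_sym by (auto simp: star_at_def)
  moreover have "adj v b" if "adj w b" "b \<noteq> v" for b
    using no_extension[of w v b] that \<open>adj v w\<close> adj_irrefl adj_sym by (auto simp: star_at_def)
  ultimately show ?thesis
    using \<open>adj v w\<close> by (auto simp: twins_def)
qed

lemma star_at_adj_iff:
  assumes "star_at G c J" "a \<in> insert c J" "b \<in> insert c J"
  shows "adj a b \<longleftrightarrow> (a = c) \<noteq> (b = c)"
proof -
  have "c \<notin> J"
    and arcs: "parcs G \<inter> insert c J \<times> insert c J = {c} \<times> J \<union> J \<times> {c}"
    using assms(1) by (simp_all add: star_at_iff_arcs)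
  have "adj a b \<longleftrightarrow> (a, b) \<in> parcs G \<inter> insert c J \<times> insert c J"
    using assms(2,3) by blast
  also have "\<dots> \<longleftrightarrow> (a = c) \<noteq> (b = c)"
    unfolding arcs using assms(2,3) \<open>c \<notin> J\<close> by auto
  finally show ?thesis .
qed

lemma maximal_star_if_twins:
  assumes "twins G v w"
  shows "is_maximal_star (with_proj G) {v, w}"
proof -
  have "adj v w" and twins: "\<And>b. b \<noteq> v \<Longrightarrow> b \<noteq> w \<Longrightarrow> adj v b \<longleftrightarrow> adj w b"
    using assms adj_verts unfolding twins_def by blast+
  have "insert c J = {v, w}" if J: "star_at G c J" "{v, w} \<subseteq> insert c J" for c J
  proof (rule ccontr)
    assume "insert c J \<noteq> {v, w}"
    then obtain x where x: "x \<in> insert c J" "x \<noteq> v" "x \<noteq> w"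
      using J(2) by blast
    have "(v = c) \<noteq> (w = c)"
      using star_at_adj_iff[OF J(1), of v w] J(2) \<open>adj v w\<close> by simp
    moreover have "adj v x \<longleftrightarrow> (v = c) \<noteq> (x = c)" "adj w x \<longleftrightarrow> (w = c) \<noteq> (x = c)"
      using star_at_adj_iff[OF J(1)] J(2) x(1) by auto
    ultimately show False
      using twins x(2,3) by auto
  qed
  moreover have "star_at G v {w}"
    using \<open>adj v w\<close> adj_irrefl by (simp add: star_at_def)
  ultimately show ?thesis
    unfolding is_maximal_star_iff by blast
qed

lemma covers_leaves_if_maximal_star:
  assumes max: "is_maximal_star (with_proj G) (insert v I)" and star: "star_at G v I"
    and two: "a \<in> I" "b \<in> I" "a \<noteq> b"
  shows "covers_leaves G v I"
proof -
  have "\<exists>w \<in> I. w = u \<or> adj w u" if "adj v u" for u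
  proof (rule ccontr)
    assume uncovered: "\<not> (\<exists>w \<in> I. w = u \<or> adj w u)"
    then have "star_at G v (insert u I)"
      using star that adj_irrefl adj_sym by (auto simp: star_at_def)
    then have "insert v (insert u I) = insert v I"
      by (rule maximal_starD[OF max]) blast
    then have "u = v \<or> u \<in> I"
      by blast
    then show False
      using uncovered that adj_irrefl by auto
  qed
  moreover have "proper_leaf G v w" if "w \<in> I" for w
    using proper_leaf_if_star_at[OF star] that two by metis
  moreover have "a \<in> pverts G"
    using star two(1) adj_verts by (auto simp: star_at_def)
  ultimately show ?thesis
    using two(1) unfolding covers_leaves_def by (metis proper_leaf_def)
qed

lemma maximal_star_if_covers_leaves:
  assumes star: "star_at G v I" and covers: "covers_leaves G v I"
    and two: "a \<in> I" "b \<in> I" "a \<noteq> b"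
  shows "is_maximal_star (with_proj G) (insert v I)"
proof -
  have "insert c J = insert v I" if J: "star_at G c J" "insert v I \<subseteq> insert c J" for c J
  proof -
    have J_indep: "\<not> adj x y" if "x \<in> J" "y \<in> J" for x y
      using J(1) that by (auto simp: star_at_def)
    have "c = v"
    proof (rule ccontr)
      assume "c \<noteq> v"
      then have "v \<in> J" "a \<in> J \<or> b \<in> J"
        using J(2) two by blast+
      then show False
        using J_indep star two by (auto simp: star_at_def)
    qed
    then have "I \<subseteq> J"
      using J(2) star adj_irrefl by (auto simp: star_at_def)
    moreover have "x \<in> I" if "x \<in> J" for x
    proof (rule ccontr)
      assume "x \<notin> I"
      then have "proper_leaf G v x"
        using proper_leaf_if_star_at[of v J x a] J(1) that two(1) \<open>I \<subseteq> J\<close> \<open>c = v\<close> by blast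
      then obtain w where "w \<in> I" "w = x \<or> adj w x"
        using covers adj_verts unfolding covers_leaves_def proper_leaf_def by blast
      then show False
        using J_indep that \<open>I \<subseteq> J\<close> \<open>x \<notin> I\<close> by blast
    qed
    ultimately show ?thesis
      using \<open>c = v\<close> by blast
  qed
  then show ?thesis
    unfolding is_maximal_star_iff using star by blast
qed

lemma no_forbidden_copy:
  assumes free: "W4_dart_gem_free (with_proj G)" and H: "H \<in> {W4_graph, dart_graph, gem_graph}"
    and vs: "length vs = 5" "card (set vs) = 5" "set vs \<subseteq> pverts G"
  shows "\<not> (\<forall>i < 5. \<forall>j < 5. adj (vs ! i) (vs ! j) \<longleftrightarrow> (i, j) \<in> parcs H)"
proof
  assume "\<forall>i < 5. \<forall>j < 5. adj (vs ! i) (vs ! j) \<longleftrightarrow> (i, j) \<in> parcs H"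
  moreover have "distinct vs"
    using vs(1,2) by (intro card_distinct) simp
  moreover have "pverts H = {..<length vs}"
    using H vs(1) pverts_forbidden_graphs by auto
  ultimately have "induced_embedding H G (\<lambda>i. vs ! i)"
    using vs(1,3) by (auto simp: induced_embedding_def inj_on_nth)
  then show False
    using free H unfolding W4_dart_gem_free_iff by blast
qed

text \<open>
  Otherwise \<open>a\<close>, \<open>b\<close>, \<open>c\<close>, \<open>v\<close> and a neighbor \<open>d\<close> of \<open>v\<close> that is not adjacent to \<open>b\<close> span \<open>W\<^sub>4\<close>, a
  gem or a dart, depending on which of \<open>a\<close> and \<open>c\<close> are adjacent to \<open>d\<close>. It follows that the proper
  leaves at \<open>v\<close> induce a disjoint union of cliques.
\<close>

lemma proper_leaf_trans:
  assumes free: "W4_dart_gem_free (with_proj G)"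
    and leaf: "proper_leaf G v b"
    and neighbors: "adj v a" "adj v c" and path: "adj a b" "adj b c" and "a \<noteq> c"
  shows "adj a c"
proof (rule ccontr)
  assume "\<not> adj a c"
  obtain d where d: "adj v d" "d \<noteq> b" "\<not> adj b d" and "adj v b"
    using leaf unfolding proper_leaf_def by blast
  have "distinct [v, a, b, c, d]"
    using neighbors path d \<open>adj v b\<close> \<open>a \<noteq> c\<close> adj_irrefl adj_sym by auto
  then have card: "card {v, a, b, c, d} = 5"
    by simp
  have verts: "{v, a, b, c, d} \<subseteq> pverts G"
    using adj_verts[of v a] adj_verts[of b c] adj_verts[of v d] neighbors path d by simp
  have no_copy: "\<not> (\<forall>i < 5. \<forall>j < 5. adj (vs ! i) (vs ! j) \<longleftrightarrow> (i, j) \<in> parcs H)"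
    if "H \<in> {W4_graph, dart_graph, gem_graph}" "length vs = 5" "set vs = {v, a, b, c, d}" for H vs
    using no_forbidden_copy[OF free that(1,2)] card verts unfolding that(3) .
  have reversed: "adj a v" "adj c v" "adj b a" "adj c b" "adj d v" "adj b v" "\<not> adj c a" "\<not> adj d b"
      "adj d a \<longleftrightarrow> adj a d" "adj d c \<longleftrightarrow> adj c d"
    using adj_sym neighbors path d \<open>adj v b\<close> \<open>\<not> adj a c\<close> by blast+
  note adjacencies = reversed neighbors path d \<open>adj v b\<close> \<open>\<not> adj a c\<close> adj_irrefl
  note graph_defs = W4_graph_def gem_graph_def dart_graph_def undirected_def numeral_eq_Suc
    All_less_Suc
  have "\<not> (adj a d \<and> adj c d)"
    using no_copy[of W4_graph "[a, b, c, d, v]"] adjacencies by (auto simp: graph_defs)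
  moreover have "\<not> (\<not> adj a d \<and> adj c d)"
    using no_copy[of gem_graph "[a, b, c, d, v]"] adjacencies by (auto simp: graph_defs)
  moreover have "\<not> (adj a d \<and> \<not> adj c d)"
    using no_copy[of gem_graph "[c, b, a, d, v]"] adjacencies by (auto simp: graph_defs)
  moreover have "\<not> (\<not> adj a d \<and> \<not> adj c d)"
    using no_copy[of dart_graph "[v, b, a, c, d]"] adjacencies by (auto simp: graph_defs)
  ultimately show False
    by blast
qed

lemma proper_leaf_nonneighbor:
  assumes "proper_leaf G v a"
  obtains b where "proper_leaf G v b" "b \<noteq> a" "\<not> adj a b"
proof -
  obtain b where "adj v b" "b \<noteq> a" "\<not> adj a b"
    using assms unfolding proper_leaf_def by blast
  moreover have "adj v a" "a \<in> pverts G"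
    using assms adj_verts by (auto simp: proper_leaf_def)
  ultimately have "proper_leaf G v b"
    unfolding proper_leaf_def using adj_sym by blast
  then show thesis
    using that \<open>b \<noteq> a\<close> \<open>\<not> adj a b\<close> by blast
qed

lemma two_leaves_if_covers_leaves:
  assumes free: "W4_dart_gem_free (with_proj G)" and covers: "covers_leaves G v I"
  obtains a b where "a \<in> I" "b \<in> I" "a \<noteq> b"
proof -
  obtain u where u: "proper_leaf G v u"
    using covers unfolding covers_leaves_def by blast
  then obtain t where t: "proper_leaf G v t" "t \<noteq> u" "\<not> adj u t"
    by (rule proper_leaf_nonneighbor)
  have verts: "u \<in> pverts G" "t \<in> pverts G"
    using u t(1) adj_verts by (auto simp: proper_leaf_def)
  obtain a where a: "a \<in> I" "proper_leaf G v a" "a = u \<or> adj a u"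
    using covers u verts(1) unfolding covers_leaves_def by blast
  obtain b where b: "b \<in> I" "b = t \<or> adj b t"
    using covers t(1) verts(2) unfolding covers_leaves_def by blast
  have "a \<noteq> b"
  proof
    assume "a = b"
    then have "adj u a" "adj a t"
      using a(3) b(2) t(2,3) adj_sym by blast+
    then have "adj u t"
      using proper_leaf_trans[OF free a(2)] u t(1,2) by (auto simp: proper_leaf_def)
    then show False
      using t(3) by blast
  qed
  then show thesis
    using that a(1) b(1) by blast
qed

lemma ex_maximal_independent_subset:
  assumes "finite C"
  shows "\<exists>I \<subseteq> C. (\<forall>a \<in> I. \<forall>b \<in> I. \<not> adj a b) \<and> (\<forall>c \<in> C. \<exists>i \<in> I. i = c \<or> adj i c)"
proof -
  define F where "F = {I. I \<subseteq> C \<and> (\<forall>a \<in> I. \<forall>b \<in> I. \<not> adj a b)}"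
  have "finite F" "{} \<in> F"
    using assms by (auto simp: F_def)
  then obtain I where I: "I \<in> F" and max: "\<And>J. J \<in> F \<Longrightarrow> I \<subseteq> J \<Longrightarrow> J = I"
    using finite_has_maximal[of F] by (metis empty_iff)
  have "\<exists>i \<in> I. i = c \<or> adj i c" if "c \<in> C" for c
  proof (rule ccontr)
    assume uncovered: "\<not> (\<exists>i \<in> I. i = c \<or> adj i c)"
    then have "insert c I \<in> F"
      using I that adj_irrefl adj_sym by (auto simp: F_def)
    then have "insert c I = I"
      by (rule max) blast
    then show False
      using uncovered by blast
  qed
  then show ?thesis
    using I unfolding F_def by blast
qed

lemma star_at_if_covers_leaves:
  assumes free: "W4_dart_gem_free (with_proj G)" and covers: "covers_leaves G v C"
  obtains I where "I \<subseteq> C" "star_at G v I" "covers_leaves G v I"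
proof -
  let ?C = "{w \<in> C. proper_leaf G v w}"
  have "?C \<subseteq> pverts G"
    using adj_verts by (auto simp: proper_leaf_def)
  then have "finite ?C"
    using pair_finite_verts finite_subset by blast
  then obtain I where I: "I \<subseteq> ?C" and indep: "\<forall>a \<in> I. \<forall>b \<in> I. \<not> adj a b"
    and dominates: "\<forall>c \<in> ?C. \<exists>i \<in> I. i = c \<or> adj i c"
    using ex_maximal_independent_subset[of ?C] by blast
  have "\<exists>i \<in> I. i = u \<or> adj i u" if u: "u \<in> pverts G" "proper_leaf G v u" for u
  proof -
    obtain w where w: "w \<in> ?C" "w = u \<or> adj w u"
      using covers u unfolding covers_leaves_def by blast
    then obtain i where i: "i \<in> I" "i = w \<or> adj i w"
      using dominates by blast
    moreover have "adj i u" if "adj i w" "adj w u" "i \<noteq> u"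
      using proper_leaf_trans[OF free _ _ _ that] w(1) i(1) I u(2) by (auto simp: proper_leaf_def)
    ultimately show ?thesis
      using w(2) by blast
  qed
  then have "covers_leaves G v I"
    using covers I unfolding covers_leaves_def by blast
  moreover from this have "star_at G v I"
    using I indep by (auto simp: star_at_def proper_leaf_def covers_leaves_def)
  ultimately show thesis
    using that I by blast
qed

lemma twins_or_covers_leaves_if_maximal_star:
  assumes star: "star_at G v I" and max: "is_maximal_star (with_proj G) (insert v I)"
  shows "(\<exists>w \<in> I. twins G v w) \<or> covers_leaves G v I"
proof -
  obtain w where w: "w \<in> I"
    using star by (auto simp: star_at_def)
  show ?thesis
  proof (cases "I = {w}")
    case True
    then show ?thesis
      using twins_if_maximal_star max star by (auto simp: star_at_def)
  next
    case False
    then obtain b where "b \<in> I" "w \<noteq> b"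
      using w by blast
    then show ?thesis
      using covers_leaves_if_maximal_star[OF max star w] by blast
  qed
qed

theorem maximal_star_within_iff:
  assumes free: "W4_dart_gem_free (with_proj G)"
  shows "(\<exists>W \<subseteq> C. is_maximal_star (with_proj G) W) \<longleftrightarrow>
    (\<exists>v \<in> C. (\<exists>w \<in> C. twins G v w) \<or> covers_leaves G v C)"
proof
  assume "\<exists>W \<subseteq> C. is_maximal_star (with_proj G) W"
  then obtain W where W: "W \<subseteq> C" "is_maximal_star (with_proj G) W"
    by blast
  from W(2) obtain v I where vI: "W = insert v I" "star_at G v I"
    unfolding is_maximal_star_iff by (elim conjE exE)
  then have "(\<exists>w \<in> I. twins G v w) \<or> covers_leaves G v I"
    using twins_or_covers_leaves_if_maximal_star W(2) by simp
  moreover have "v \<in> C" and I: "I \<subseteq> C"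
    using W(1) vI(1) by simp_all
  ultimately have "(\<exists>w \<in> C. twins G v w) \<or> covers_leaves G v C"
    using covers_leaves_mono[OF _ I] by (elim disjE) (blast, simp)
  then show "\<exists>v \<in> C. (\<exists>w \<in> C. twins G v w) \<or> covers_leaves G v C"
    using \<open>v \<in> C\<close> by (rule bexI)
next
  assume "\<exists>v \<in> C. (\<exists>w \<in> C. twins G v w) \<or> covers_leaves G v C"
  then consider v w where "v \<in> C" "w \<in> C" "twins G v w" | v where "v \<in> C" "covers_leaves G v C"
    by blast
  then show "\<exists>W \<subseteq> C. is_maximal_star (with_proj G) W"
  proof cases
    case 1
    then show ?thesis
      using maximal_star_if_twins by (intro exI[of _ "{v, w}"]) blast
  next
    case 2
    obtain I where "I \<subseteq> C" "star_at G v I" "covers_leaves G v I"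
      using star_at_if_covers_leaves[OF free 2(2)] .
    moreover obtain a b where "a \<in> I" "b \<in> I" "a \<noteq> b"
      using two_leaves_if_covers_leaves[OF free \<open>covers_leaves G v I\<close>] .
    ultimately show ?thesis
      using maximal_star_if_covers_leaves 2(1) by (intro exI[of _ "insert v I"]) blast
  qed
qed

end

lemma maximal_star_nonempty: "is_maximal_star G W \<Longrightarrow> W \<noteq> {}"
  by (auto simp: is_maximal_star_def is_star_def complete_bipartite_digraph_def)

lemma cover_if_star_coloring:
  assumes \<rho>: "is_star_coloring k G \<rho>"
  defines "P \<equiv> \<lambda>c. {v \<in> verts G. \<rho> v = Suc c}"
  shows "\<forall>v \<in> verts G. \<exists>c < k. v \<in> P c" "\<forall>c < k. \<forall>W \<subseteq> P c. \<not> is_maximal_star G W"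
proof -
  have "\<exists>c < k. v \<in> P c" if "v \<in> verts G" for v
  proof -
    have "\<rho> v \<in> {1..k}"
      using \<rho> that unfolding is_star_coloring_def is_coloring_def by blast
    then show ?thesis
      using that by (intro exI[of _ "\<rho> v - 1"]) (auto simp: P_def)
  qed
  then show "\<forall>v \<in> verts G. \<exists>c < k. v \<in> P c"
    by blast
  have "\<not> is_maximal_star G W" if "W \<subseteq> P c" for W c
  proof
    assume max: "is_maximal_star G W"
    then have "\<rho> ` W = {Suc c}"
      using that maximal_star_nonempty[OF max] by (force simp: P_def)
    then show False
      using \<rho> max by (auto simp: is_star_coloring_def monochromatic_def)
  qed
  then show "\<forall>c < k. \<forall>W \<subseteq> P c. \<not> is_maximal_star G W"
    by blast
qed

lemma star_coloring_if_cover: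
  assumes cover: "\<forall>v \<in> verts G. \<exists>c < k. v \<in> P c"
    and no_star: "\<forall>c < k. \<forall>W \<subseteq> P c. \<not> is_maximal_star G W"
  shows "\<exists>\<rho>. is_star_coloring k G \<rho>"
proof -
  obtain col where col: "\<And>v. v \<in> verts G \<Longrightarrow> col v < k \<and> v \<in> P (col v)"
    using bchoice[OF cover] by blast
  have "\<not> monochromatic (\<lambda>v. Suc (col v)) W" if max: "is_maximal_star G W" for W
  proof
    assume "monochromatic (\<lambda>v. Suc (col v)) W"
    then obtain x where x: "(\<lambda>v. Suc (col v)) ` W = {x}"
      by (auto simp: monochromatic_def card_1_singleton_iff)
    obtain u where "u \<in> W"
      using maximal_star_nonempty[OF max] by blast
    have "W \<subseteq> verts G"
      using max by (simp add: is_maximal_star_def is_star_def)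
    moreover have "col v = col u" if "v \<in> W" for v
      using x that \<open>u \<in> W\<close> by (metis imageI singletonD Suc_inject)
    ultimately have "col u < k" "W \<subseteq> P (col u)"
      using col \<open>u \<in> W\<close> by (blast, metis subsetD subsetI)
    then show False
      using no_star max by blast
  qed
  moreover have "is_coloring k G (\<lambda>v. Suc (col v))"
    using col by (auto simp: is_coloring_def Suc_le_eq)
  ultimately show ?thesis
    unfolding is_star_coloring_def by blast
qed

section \<open>A certificate for connectedness\<close>

definition connecting_order :: "'a pair_pre_digraph \<Rightarrow> ('a \<Rightarrow> 'a \<Rightarrow> bool) \<Rightarrow> bool" where
  "connecting_order G prec \<longleftrightarrow> irreflp_on (pverts G) prec \<and> transp_on (pverts G) prec \<and>
     (\<exists>r \<in> pverts G. \<forall>i \<in> pverts G. i \<noteq> r \<longrightarrow> (\<exists>j \<in> pverts G. prec j i \<and> (i, j) \<in> parcs G))"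

context pair_graph
begin

lemma connected_if_connecting_order:
  assumes "connecting_order G prec"
  shows "Digraph_Component.connected (with_proj G)"
proof -
  obtain r where r: "r \<in> pverts G"
    and order: "irreflp_on (pverts G) prec" "transp_on (pverts G) prec"
    and smaller: "\<And>i. i \<in> pverts G \<Longrightarrow> i \<noteq> r \<Longrightarrow> \<exists>j \<in> pverts G. prec j i \<and> adj i j"
    using assms unfolding connecting_order_def by blast
  let ?U = "{i \<in> pverts G. \<not> i \<rightarrow>\<^sup>*\<^bsub>with_proj G\<^esub> r}"
  have "?U = {}"
  proof (rule ccontr)
    have "irreflp_on ?U prec" "transp_on ?U prec"
      using order by (auto simp: irreflp_on_def elim: transp_on_subset)
    then have "asymp_on ?U prec" "transp_on ?U prec"
      by (simp_all add: asymp_on_iff_irreflp_on_if_transp_on)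
    moreover assume "?U \<noteq> {}"
    ultimately obtain i where i: "i \<in> ?U" and minimal: "\<And>j. j \<in> ?U \<Longrightarrow> j \<noteq> i \<Longrightarrow> \<not> prec j i"
      using Finite_Set.bex_min_element[of ?U prec] pair_finite_verts by auto
    then obtain j where j: "j \<in> pverts G" "prec j i" "adj i j"
      using smaller r by (metis (mono_tags, lifting) mem_Collect_eq reachable_refl)
    have "j \<noteq> i"
      using j(3) adj_irrefl by blast
    then have "j \<rightarrow>\<^sup>*\<^bsub>with_proj G\<^esub> r"
      using minimal j by blast
    then show False
      using i j(3) adj_reachable_trans by auto
  qed
  then have "i \<rightarrow>\<^sup>*\<^bsub>with_proj G\<^esub> j" if "i \<in> pverts G" "j \<in> pverts G" for i j
    using that symmetric_reachable' reachable_trans by blast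
  then have "i \<rightarrow>\<^sup>*\<^bsub>with_proj (mk_symmetric (with_proj G))\<^esub> j"
    if "i \<in> pverts G" "j \<in> pverts G" for i j
    using that reachable_mk_symmetricI by blast
  then show ?thesis
    unfolding connected_def strongly_connected_def using r by (auto simp: mk_symmetric_def)
qed

text \<open>The order compares the distances from an arbitrary root.\<close>

lemma connecting_order_if_connected:
  assumes conn: "Digraph_Component.connected (with_proj G)"
  obtains prec where "connecting_order G prec"
proof -
  have strong: "strongly_connected (with_proj G)"
    using symmetric_connected_imp_strongly_connected[OF pair_sym_arcs conn] .
  then obtain r where r: "r \<in> pverts G"
    by (auto simp: strongly_connected_def)
  define d where "d i = (LEAST m. (r, i) \<in> parcs G ^^ m)" for i
  have "\<exists>j \<in> pverts G. d j < d i \<and> adj i j" if i: "i \<in> pverts G" "i \<noteq> r" for i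
  proof -
    have "r \<rightarrow>\<^sup>*\<^bsub>with_proj G\<^esub> i"
      using strong r i(1) by (simp add: strongly_connected_def)
    then have "\<exists>m. (r, i) \<in> parcs G ^^ m"
      using reachable_rtranclI rtrancl_imp_relpow by fastforce
    then have path: "(r, i) \<in> parcs G ^^ d i"
      unfolding d_def by (rule LeastI_ex)
    then obtain m where m: "d i = Suc m"
      using i(2) by (cases "d i") auto
    then obtain j where j: "(r, j) \<in> parcs G ^^ m" "adj j i"
      using path by auto
    then have "d j \<le> m"
      unfolding d_def by (intro Least_le)
    then show ?thesis
      using m j(2) adj_sym adj_verts by (metis le_imp_less_Suc)
  qed
  then have "connecting_order G (\<lambda>i j. d i < d j)"
    using r by (auto simp: connecting_order_def irreflp_on_def transp_on_def)
  then show thesis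
    by (rule that)
qed

end

section \<open>Star colorings in existential second-order logic\<close>

definition Or :: "fo \<Rightarrow> fo \<Rightarrow> fo" where
  "Or \<phi> \<psi> = Neg (And (Neg \<phi>) (Neg \<psi>))"

definition Imp :: "fo \<Rightarrow> fo \<Rightarrow> fo" where
  "Imp \<phi> \<psi> = Neg (And \<phi> (Neg \<psi>))"

definition Iff :: "fo \<Rightarrow> fo \<Rightarrow> fo" where
  "Iff \<phi> \<psi> = And (Imp \<phi> \<psi>) (Imp \<psi> \<phi>)"

definition Forall :: "nat \<Rightarrow> fo \<Rightarrow> fo" where
  "Forall x \<phi> = Neg (Exists x (Neg \<phi>))"

fun Conj :: "fo list \<Rightarrow> fo" where
  "Conj [] = Eq 0 0"
| "Conj (\<phi> # \<phi>s) = And \<phi> (Conj \<phi>s)"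

definition Disj :: "fo list \<Rightarrow> fo" where
  "Disj \<phi>s = Neg (Conj (map Neg \<phi>s))"

lemma fo_sat_Conj [simp]: "fo_sat n R e (Conj \<phi>s) \<longleftrightarrow> (\<forall>\<phi> \<in> set \<phi>s. fo_sat n R e \<phi>)"
  by (induction \<phi>s) auto

lemma fo_sat_connectives [simp]:
  "fo_sat n R e (Or \<phi> \<psi>) \<longleftrightarrow> fo_sat n R e \<phi> \<or> fo_sat n R e \<psi>"
  "fo_sat n R e (Imp \<phi> \<psi>) \<longleftrightarrow> (fo_sat n R e \<phi> \<longrightarrow> fo_sat n R e \<psi>)"
  "fo_sat n R e (Iff \<phi> \<psi>) \<longleftrightarrow> (fo_sat n R e \<phi> \<longleftrightarrow> fo_sat n R e \<psi>)"
  "fo_sat n R e (Forall x \<phi>) \<longleftrightarrow> (\<forall>v < n. fo_sat n R (e(x := v)) \<phi>)"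
  "fo_sat n R e (Disj \<phi>s) \<longleftrightarrow> (\<exists>\<phi> \<in> set \<phi>s. fo_sat n R e \<phi>)"
  by (auto simp: Or_def Imp_def Iff_def Forall_def Disj_def)

lemma fo_sat_foldr_Exists:
  "fo_sat n R e (foldr Exists xs \<phi>) \<longleftrightarrow>
    (\<exists>f. (\<forall>x \<in> set xs. f x < n) \<and> fo_sat n R (override_on e f (set xs)) \<phi>)"
proof (induction xs arbitrary: e)
  case (Cons x xs)
  have override: "override_on (e(x := v)) f (set xs) =
      override_on e (if x \<in> set xs then f else f(x := v)) (insert x (set xs))" for v f
    by (auto simp: override_on_def fun_eq_iff)
  have override': "override_on e f (insert x (set xs)) = override_on (e(x := f x)) f (set xs)" for f
    by (auto simp: override_on_def fun_eq_iff)
  have "fo_sat n R e (foldr Exists (x # xs) \<phi>) \<longleftrightarrow> (\<exists>v < n. \<exists>f. (\<forall>y \<in> set xs. f y < n) \<and>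
      fo_sat n R (override_on (e(x := v)) f (set xs)) \<phi>)"
    by (simp only: foldr.simps comp_apply fo_sat.simps Cons.IH)
  also have "\<dots> \<longleftrightarrow> (\<exists>f. (\<forall>y \<in> set (x # xs). f y < n) \<and>
      fo_sat n R (override_on e f (set (x # xs))) \<phi>)"
  proof
    assume "\<exists>v < n. \<exists>f. (\<forall>y \<in> set xs. f y < n) \<and>
      fo_sat n R (override_on (e(x := v)) f (set xs)) \<phi>"
    then obtain v f where "v < n" "\<forall>y \<in> set xs. f y < n"
        "fo_sat n R (override_on (e(x := v)) f (set xs)) \<phi>"
      by blast
    then show "\<exists>f. (\<forall>y \<in> set (x # xs). f y < n) \<and> fo_sat n R (override_on e f (set (x # xs))) \<phi>"
      unfolding override by (intro exI[of _ "if x \<in> set xs then f else f(x := v)"]) auto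
  qed (auto simp: override')
  finally show ?case .
qed simp

text \<open>The vertices of \<open>H\<close> are the variables, so that a satisfying environment is an embedding.\<close>

definition induced_fo :: "nat \<Rightarrow> nat pair_pre_digraph \<Rightarrow> fo" where
  "induced_fo m H = foldr Exists [0..<m] (Conj (map (\<lambda>(i, j).
     And (if (i, j) \<in> parcs H then Rel 0 i j else Neg (Rel 0 i j))
         (if i = j then Eq i j else Neg (Eq i j)))
     (List.product [0..<m] [0..<m])))"

lemma fo_sat_induced_fo:
  assumes "pverts H = {..<m}"
  shows "fo_sat n R e (induced_fo m H) \<longleftrightarrow> (\<exists>f. induced_embedding H (digraph_of n (R 0)) f)"
  by (auto simp: induced_fo_def fo_sat_foldr_Exists induced_embedding_def assms inj_on_def
      image_subset_iff atLeast0LessThan)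

definition irrefl_fo :: "nat \<Rightarrow> fo" where
  "irrefl_fo r = Forall 0 (Neg (Rel r 0 0))"

lemma fo_sat_irrefl_fo [simp]: "fo_sat n R e (irrefl_fo r) \<longleftrightarrow> irreflp_on {..<n} (R r)"
  by (simp add: irrefl_fo_def irreflp_on_def Ball_def)

definition sym_fo :: "nat \<Rightarrow> fo" where
  "sym_fo r = Forall 0 (Forall 1 (Imp (Rel r 0 1) (Rel r 1 0)))"

lemma fo_sat_sym_fo [simp]: "fo_sat n R e (sym_fo r) \<longleftrightarrow> symp_on {..<n} (R r)"
  by (simp add: sym_fo_def symp_on_def Ball_def)

definition trans_fo :: "nat \<Rightarrow> fo" where
  "trans_fo r = Forall 0 (Forall 1 (Forall 2 (Imp (Rel r 0 1) (Imp (Rel r 1 2) (Rel r 0 2)))))"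

lemma fo_sat_trans_fo [simp]: "fo_sat n R e (trans_fo r) \<longleftrightarrow> transp_on {..<n} (R r)"
  by (simp add: trans_fo_def transp_on_def Ball_def) blast

lemma pair_graph_digraph_of_iff:
  "pair_graph (digraph_of n E) \<longleftrightarrow> irreflp_on {..<n} E \<and> symp_on {..<n} E"
proof
  assume "pair_graph (digraph_of n E)"
  then interpret pair_graph "digraph_of n E" .
  show "irreflp_on {..<n} E \<and> symp_on {..<n} E"
    using adj_irrefl adj_sym by (auto simp: irreflp_on_def symp_on_def)
next
  assume E: "irreflp_on {..<n} E \<and> symp_on {..<n} E"
  have "finite (parcs (digraph_of n E))"
    by (rule finite_subset[of _ "{..<n} \<times> {..<n}"]) auto
  then show "pair_graph (digraph_of n E)"
    using E by unfold_locales (auto simp: symmetric_def irreflp_on_def symp_on_def intro: symI)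
qed

definition graph_fo :: fo where
  "graph_fo = And (irrefl_fo 0) (sym_fo 0)"

lemma fo_sat_graph_fo [simp]: "fo_sat n R e graph_fo \<longleftrightarrow> pair_graph (digraph_of n (R 0))"
  by (simp add: graph_fo_def pair_graph_digraph_of_iff)

definition smaller_neighbors_fo :: fo where
  "smaller_neighbors_fo =
     Exists 0 (Forall 1 (Imp (Neg (Eq 1 0)) (Exists 2 (And (Rel 1 2 1) (Rel 0 1 2)))))"

lemma fo_sat_smaller_neighbors_fo [simp]:
  "fo_sat n R e smaller_neighbors_fo \<longleftrightarrow> (\<exists>r < n. \<forall>i < n. i \<noteq> r \<longrightarrow> (\<exists>j < n. R 1 j i \<and> R 0 i j))"
  by (simp add: smaller_neighbors_fo_def)

definition connecting_order_fo :: fo where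
  "connecting_order_fo = Conj [irrefl_fo 1, trans_fo 1, smaller_neighbors_fo]"

lemma fo_sat_connecting_order_fo [simp]:
  "fo_sat n R e connecting_order_fo \<longleftrightarrow> connecting_order (digraph_of n (R 0)) (R 1)"
  by (simp add: connecting_order_fo_def connecting_order_def Ball_def Bex_def cong: conj_cong)

definition twins_fo :: "nat \<Rightarrow> nat \<Rightarrow> fo" where
  "twins_fo v w = And (Rel 0 v w)
     (Forall 3 (Imp (And (Neg (Eq 3 v)) (Neg (Eq 3 w))) (Iff (Rel 0 v 3) (Rel 0 w 3))))"

lemma fo_sat_twins_fo [simp]:
  "v \<noteq> 3 \<Longrightarrow> w \<noteq> 3 \<Longrightarrow> e v < n \<Longrightarrow> e w < n \<Longrightarrow>
    fo_sat n R e (twins_fo v w) \<longleftrightarrow> twins (digraph_of n (R 0)) (e v) (e w)"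
  by (auto simp: twins_fo_def twins_def)

definition proper_leaf_fo :: "nat \<Rightarrow> nat \<Rightarrow> fo" where
  "proper_leaf_fo v a = And (Rel 0 v a)
     (Exists 3 (Conj [Rel 0 v 3, Neg (Eq 3 a), Neg (Rel 0 a 3)]))"

lemma fo_sat_proper_leaf_fo [simp]:
  "v \<noteq> 3 \<Longrightarrow> a \<noteq> 3 \<Longrightarrow> e v < n \<Longrightarrow> e a < n \<Longrightarrow>
    fo_sat n R e (proper_leaf_fo v a) \<longleftrightarrow> proper_leaf (digraph_of n (R 0)) (e v) (e a)"
  by (auto simp: proper_leaf_fo_def proper_leaf_def)

text \<open>The color class \<open>c\<close> consists of the loops of relation \<open>c + 2\<close>.\<close>

definition color_fo :: "nat \<Rightarrow> nat \<Rightarrow> fo" where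
  "color_fo c v = Rel (c + 2) v v"

lemma fo_sat_color_fo [simp]: "fo_sat n R e (color_fo c v) \<longleftrightarrow> R (c + 2) (e v) (e v)"
  by (simp add: color_fo_def)

definition color_class :: "nat \<Rightarrow> (nat \<Rightarrow> nat \<Rightarrow> nat \<Rightarrow> bool) \<Rightarrow> nat \<Rightarrow> nat set" where
  "color_class n R c = {v. v < n \<and> R (c + 2) v v}"

lemma mem_color_class_iff [simp]: "v \<in> color_class n R c \<longleftrightarrow> v < n \<and> R (c + 2) v v"
  by (simp add: color_class_def)

definition covers_leaves_fo :: "nat \<Rightarrow> nat \<Rightarrow> fo" where
  "covers_leaves_fo c v = And (Exists 1 (proper_leaf_fo v 1))
     (Forall 1 (Imp (proper_leaf_fo v 1)
       (Exists 2 (Conj [color_fo c 2, proper_leaf_fo v 2, Or (Eq 2 1) (Rel 0 2 1)]))))"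

lemma fo_sat_covers_leaves_fo [simp]:
  "v = 0 \<Longrightarrow> e v < n \<Longrightarrow> fo_sat n R e (covers_leaves_fo c v) \<longleftrightarrow>
    covers_leaves (digraph_of n (R 0)) (e v) (color_class n R c)"
  by (simp add: covers_leaves_fo_def covers_leaves_def Bex_def Ball_def cong: conj_cong)

definition maximal_star_fo :: "nat \<Rightarrow> fo" where
  "maximal_star_fo c = Exists 0 (And (color_fo c 0)
     (Or (Exists 1 (And (color_fo c 1) (twins_fo 0 1))) (covers_leaves_fo c 0)))"

lemma fo_sat_maximal_star_fo:
  assumes "pair_graph (digraph_of n (R 0))" "W4_dart_gem_free (with_proj (digraph_of n (R 0)))"
  shows "fo_sat n R e (maximal_star_fo c) \<longleftrightarrow>
    (\<exists>W \<subseteq> color_class n R c. is_maximal_star (with_proj (digraph_of n (R 0))) W)"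
  unfolding pair_graph.maximal_star_within_iff[OF assms]
  by (simp add: maximal_star_fo_def Bex_def cong: conj_cong)

definition W4_dart_gem_free_fo :: fo where
  "W4_dart_gem_free_fo = Conj (map (\<lambda>H. Neg (induced_fo 5 H)) [W4_graph, dart_graph, gem_graph])"

lemma fo_sat_W4_dart_gem_free_fo [simp]:
  "fo_sat n R e W4_dart_gem_free_fo \<longleftrightarrow> W4_dart_gem_free (with_proj (digraph_of n (R 0)))"
  by (simp add: W4_dart_gem_free_fo_def W4_dart_gem_free_iff fo_sat_induced_fo
      pverts_forbidden_graphs)

definition color_cover_fo :: "nat \<Rightarrow> fo" where
  "color_cover_fo k = Forall 0 (Disj (map (\<lambda>c. color_fo c 0) [0..<k]))"

lemma fo_sat_color_cover_fo [simp]: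
  "fo_sat n R e (color_cover_fo k) \<longleftrightarrow> (\<forall>v < n. \<exists>c < k. v \<in> color_class n R c)"
  by (simp add: color_cover_fo_def Bex_def)

definition no_monochromatic_star_fo :: "nat \<Rightarrow> fo" where
  "no_monochromatic_star_fo k = Conj (map (\<lambda>c. Neg (maximal_star_fo c)) [0..<k])"

lemma fo_sat_no_monochromatic_star_fo [simp]:
  assumes "pair_graph (digraph_of n (R 0))" "W4_dart_gem_free (with_proj (digraph_of n (R 0)))"
  shows "fo_sat n R e (no_monochromatic_star_fo k) \<longleftrightarrow>
    (\<forall>c < k. \<forall>W \<subseteq> color_class n R c. \<not> is_maximal_star (with_proj (digraph_of n (R 0))) W)"
  using assms by (simp add: no_monochromatic_star_fo_def fo_sat_maximal_star_fo atLeast0LessThan)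
     (simp add: Ball_def)

definition star_coloring_fo :: "nat \<Rightarrow> fo" where
  "star_coloring_fo k = Conj [graph_fo, connecting_order_fo, W4_dart_gem_free_fo, color_cover_fo k,
     no_monochromatic_star_fo k]"

lemma fo_sat_star_coloring_fo:
  "fo_sat n R e (star_coloring_fo k) \<longleftrightarrow>
    (let G = digraph_of n (R 0) in
      pair_graph G \<and> connecting_order G (R 1) \<and> W4_dart_gem_free (with_proj G) \<and>
      (\<forall>v < n. \<exists>c < k. v \<in> color_class n R c) \<and>
      (\<forall>c < k. \<forall>W \<subseteq> color_class n R c. \<not> is_maximal_star (with_proj G) W))"
  by (simp add: star_coloring_fo_def Let_def del: mem_color_class_iff cong: conj_cong)

lemma digraph_of_arcs:
  assumes "pair_wf_digraph G" "pverts G = {..<n}"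
  shows "digraph_of n (\<lambda>i j. (i, j) \<in> parcs G) = G"
  using pair_wf_digraph.parcs_subset[OF assms(1)] assms(2)
  by (auto simp: digraph_of_def intro!: pair_pre_digraph.equality)

lemma star_coloring_fo_complete:
  assumes G: "pair_graph G" "pverts G = {..<n}"
    and conn: "Digraph_Component.connected (with_proj G)"
    and free: "W4_dart_gem_free (with_proj G)" and col: "is_star_coloring k (with_proj G) \<rho>"
  obtains R where "digraph_of n (R 0) = G" "fo_sat n R e (star_coloring_fo k)"
proof -
  interpret pair_graph G by fact
  obtain prec where prec: "connecting_order G prec"
    using connecting_order_if_connected[OF conn] .
  obtain P where P: "\<forall>v \<in> pverts G. \<exists>c < k. v \<in> P c"
      "\<forall>c < k. \<forall>W \<subseteq> P c. \<not> is_maximal_star (with_proj G) W"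
    using cover_if_star_coloring[OF col] unfolding with_proj_simps by (rule that)
  define R where "R r = (case r of 0 \<Rightarrow> (\<lambda>i j. (i, j) \<in> parcs G) | Suc 0 \<Rightarrow> prec |
    Suc (Suc c) \<Rightarrow> (\<lambda>i j. i \<in> P c))" for r
  have R_0: "digraph_of n (R 0) = G"
    using digraph_of_arcs pair_wf_digraph G(2) by (simp add: R_def)
  moreover have "R 1 = prec" "color_class n R c = {..<n} \<inter> P c" for c
    by (auto simp: R_def color_class_def)
  ultimately have "fo_sat n R e (star_coloring_fo k)"
    using G prec free P by (auto simp: fo_sat_star_coloring_fo)
  then show thesis
    using that R_0 by blast
qed

lemma star_coloring_fo_sound:
  assumes "fo_sat n R e (star_coloring_fo k)"
  defines "G \<equiv> digraph_of n (R 0)"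
  shows "pair_graph G" "Digraph_Component.connected (with_proj G)" "W4_dart_gem_free (with_proj G)"
    "\<exists>\<rho>. is_star_coloring k (with_proj G) \<rho>"
proof -
  note sat = assms(1)[unfolded fo_sat_star_coloring_fo Let_def, folded G_def]
  show "pair_graph G" "W4_dart_gem_free (with_proj G)"
    using sat by blast+
  show "Digraph_Component.connected (with_proj G)"
    using pair_graph.connected_if_connecting_order sat by blast
  show "\<exists>\<rho>. is_star_coloring k (with_proj G) \<rho>"
  proof (rule star_coloring_if_cover)
    show "\<forall>v \<in> verts (with_proj G). \<exists>c < k. v \<in> color_class n R c"
      using sat by (simp add: G_def del: mem_color_class_iff)
  qed (use sat in blast)
qed

lemma STAR_COLORING_eq_eso_language:
  "STAR_COLORING k W4_dart_gem_free = eso_language (star_coloring_fo k)"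
proof (intro equalityI subsetI)
  fix x assume "x \<in> STAR_COLORING k W4_dart_gem_free"
  then obtain G n \<rho> where x: "x = adjacency_code G" and G: "pair_graph G" "pverts G = {..<n}"
      "Digraph_Component.connected (with_proj G)" "W4_dart_gem_free (with_proj G)"
      "is_star_coloring k (with_proj G) \<rho>"
    unfolding STAR_COLORING_def by blast
  obtain R where "digraph_of n (R 0) = G" "fo_sat n R (\<lambda>_. 0) (star_coloring_fo k)"
    using star_coloring_fo_complete[OF G] .
  moreover have "0 < n"
    using G(2,3) by (auto simp: connected_conv)
  ultimately show "x \<in> eso_language (star_coloring_fo k)"
    unfolding eso_language_def x by blast
next
  fix x assume "x \<in> eso_language (star_coloring_fo k)"
  then obtain n R where x: "x = adjacency_code (digraph_of n (R 0))"
      and "fo_sat n R (\<lambda>_. 0) (star_coloring_fo k)"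
    unfolding eso_language_def by blast
  note G = star_coloring_fo_sound[OF this(2)]
  show "x \<in> STAR_COLORING k W4_dart_gem_free"
    unfolding STAR_COLORING_def x using G pverts_digraph_of by blast
qed

theorem theorem24:
  fixes k :: nat
  shows "STAR_COLORING k W4_dart_gem_free \<in> class_NP"
  unfolding STAR_COLORING_eq_eso_language by (rule eso_language_in_class_NP)

end
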